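(* Let $\tilde d$ be a flat metric connection on $\underline{\mathbb{C}}^{n+2}$, let $V\subset\underline{\mathbb{C}}^{n+2}$ be a non-degenerate subbundle, and let $q$ be a $1$-form on $M$ with values in $\wedge^{2}V\oplus\wedge^{2}V^{\perp}\subset o(\underline{\mathbb{C}}^{n+2})$. Then $V$ is $(q,\tilde d)$-constrained harmonic if and only if $\tilde d^{\lambda,q}_{V}$ is a flat connection for each $\lambda\in\mathbb{C}\backslash\{0\}$.
   Context: $M$ is an oriented surface with a fixed conformal structure; $J$ is the induced complex structure, all $(1,0)$- and $(0,1)$-parts refer to it, and $*\omega=-\omega\circ J$ on $1$-forms. $\mathbb{R}^{n+1,1}$ ($n\ge 3$) has metric $(\,,\,)$ of signature $(n+1,1)$, extended complex bilinearly to $\mathbb{C}^{n+2}=(\mathbb{R}^{n+1,1})^{\mathbb{C}}$; $\underline{\mathbb{C}}^{n+2}=M\times\mathbb{C}^{n+2}$. We identify $\wedge^{2}\mathbb{C}^{n+2}\cong o(\mathbb{C}^{n+2})$ by $(v_1\wedge v_2)(w)=(w,v_1)v_2-(w,v_2)v_1$. A metric connection is one for which $(\,,\,)$ is parallel. For $1$-forms $\mu,\eta$ with values in a bundle of Lie algebras, $[\mu\wedge\eta](X,Y)=[\mu_X,\eta_Y]-[\mu_Y,\eta_X]$. For a connection $\nabla$ on $\underline{\mathbb{C}}^{n+2}$, $d^{\nabla}$ is the exterior derivative on $\mathrm{End}(\underline{\mathbb{C}}^{n+2})$-valued forms. For $\tilde d$, $V$ as in the claim, with orthogonal projections $\pi_V,\pi_{V^\perp}$,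 set $\mathcal{D}=\mathcal{D}_V^{\tilde d}:=\pi_V\circ\tilde d\circ\pi_V+\pi_{V^\perp}\circ\tilde d\circ\pi_{V^\perp}$ and $\mathcal{N}=\mathcal{N}_V^{\tilde d}:=\tilde d-\mathcal{D}\in\Omega^1(V\wedge V^\perp)$. $V$ is $(q,\tilde d)$-constrained harmonic if (i) $d^{\mathcal{D}}q^{1,0}=\frac12[q\wedge q]=d^{\mathcal{D}}q^{0,1}$ and (ii) $d^{\mathcal{D}}*\mathcal{N}=2[q\wedge *\mathcal{N}]$. For $\lambda\in\mathbb{C}\backslash\{0\}$, $$\tilde d^{\lambda,q}_V:=\mathcal{D}+\lambda^{-1}\mathcal{N}^{1,0}+\lambda\mathcal{N}^{0,1}+(\lambda^{-2}-1)q^{1,0}+(\lambda^2-1)q^{0,1}.$$ *)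

theory Defs
  imports "HOL-Analysis.Analysis"
begin

section \<open>Smooth maps on open subsets of Euclidean spaces\<close>

primrec Ck_on :: "'a::euclidean_space set \<Rightarrow> ('a \<Rightarrow> 'w::real_normed_vector) \<Rightarrow> nat \<Rightarrow> bool" where
  "Ck_on S f 0 \<longleftrightarrow> continuous_on S f"
| "Ck_on S f (Suc k) \<longleftrightarrow> (\<forall>x\<in>S. f differentiable (at x)) \<and>
      (\<forall>u. Ck_on S (\<lambda>x. frechet_derivative f (at x) u) k)"

definition smooth_on :: "'a::euclidean_space set \<Rightarrow> ('a \<Rightarrow> 'w::real_normed_vector) \<Rightarrow> bool" where
  "smooth_on S f \<longleftrightarrow> (\<forall>k. Ck_on S f k)"


section \<open>Oriented surfaces\<close>

text \<open>A chart is a pair of its domain and its coordinate map; only the values of the latter on the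
  domain matter.\<close>

type_synonym 'm chart = "'m set \<times> ('m \<Rightarrow> real^2)"

abbreviation chart_inv :: "'m chart \<Rightarrow> real^2 \<Rightarrow> 'm" where
  "chart_inv \<phi> \<equiv> inv_into (fst \<phi>) (snd \<phi>)"

definition chart_trans :: "'m chart \<Rightarrow> 'm chart \<Rightarrow> real^2 \<Rightarrow> real^2" where
  "chart_trans \<phi> \<psi> = snd \<psi> \<circ> chart_inv \<phi>"

definition oriented_surface ::
  "('m::{t2_space,second_countable_topology}) chart set \<Rightarrow> bool" where
  "oriented_surface A \<longleftrightarrow>
     (\<Union>\<phi>\<in>A. fst \<phi>) = UNIV \<and>
     (\<forall>\<phi>\<in>A. open (fst \<phi>) \<and> open (snd \<phi> ` fst \<phi>) \<and>
        homeomorphism (fst \<phi>) (snd \<phi> ` fst \<phi>) (snd \<phi>) (chart_inv \<phi>)) \<and>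
     (\<forall>\<phi>\<in>A. \<forall>\<psi>\<in>A. smooth_on (snd \<phi> ` (fst \<phi> \<inter> fst \<psi>)) (chart_trans \<phi> \<psi>) \<and>
        (\<forall>x \<in> snd \<phi> ` (fst \<phi> \<inter> fst \<psi>). det (jacobian (chart_trans \<phi> \<psi>) (at x)) > 0))"

definition smooth_map_on ::
  "'m chart set \<Rightarrow> 'm set \<Rightarrow> ('m \<Rightarrow> 'w::real_normed_vector) \<Rightarrow> bool" where
  "smooth_map_on A U f \<longleftrightarrow>
     (\<forall>\<phi>\<in>A. smooth_on (snd \<phi> ` (fst \<phi> \<inter> U)) (f \<circ> chart_inv \<phi>))"

abbreviation smooth_map :: "'m chart set \<Rightarrow> ('m \<Rightarrow> 'w::real_normed_vector) \<Rightarrow> bool" where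
  "smooth_map A f \<equiv> smooth_map_on A UNIV f"


section \<open>Differential forms\<close>

text \<open>The triple of a chart \<open>\<phi>\<close>, a point \<open>p\<close> of its domain and \<open>u\<close> in \<open>\<real>\<^sup>2\<close> represents the tangent
  vector at \<open>p\<close> whose coordinates in \<open>\<phi>\<close> are \<open>u\<close>; two triples at \<open>p\<close> represent the same vector iff
  their coordinates are related by the differential of the transition map. Tensors are functions
  of such representatives that respect this identification; values for \<open>p\<close> outside the domain of
  \<open>\<phi>\<close>, or for \<open>\<phi>\<close> outside the atlas, are irrelevant.\<close>

type_synonym ('m, 'w) form1 = "'m chart \<Rightarrow> 'm \<Rightarrow> real^2 \<Rightarrow> 'w"
type_synonym ('m, 'w) form2 = "'m chart \<Rightarrow> 'm \<Rightarrow> real^2 \<Rightarrow> real^2 \<Rightarrow> 'w"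

definition trans_diff :: "'m chart \<Rightarrow> 'm chart \<Rightarrow> 'm \<Rightarrow> real^2 \<Rightarrow> real^2" where
  "trans_diff \<phi> \<psi> p = frechet_derivative (chart_trans \<phi> \<psi>) (at (snd \<phi> p))"

definition one_form :: "'m chart set \<Rightarrow> ('m, 'w::real_normed_vector) form1 \<Rightarrow> bool" where
  "one_form A \<omega> \<longleftrightarrow>
     (\<forall>\<phi>\<in>A. \<forall>p\<in>fst \<phi>. linear (\<omega> \<phi> p)) \<and>
     (\<forall>\<phi>\<in>A. \<forall>\<psi>\<in>A. \<forall>p\<in>fst \<phi> \<inter> fst \<psi>. \<forall>u. \<omega> \<phi> p u = \<omega> \<psi> p (trans_diff \<phi> \<psi> p u)) \<and>
     (\<forall>\<phi>\<in>A. \<forall>u. smooth_on (snd \<phi> ` fst \<phi>) (\<lambda>x. \<omega> \<phi> (chart_inv \<phi> x) u))"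

definition eq2 :: "'m chart set \<Rightarrow> ('m, 'w) form2 \<Rightarrow> ('m, 'w) form2 \<Rightarrow> bool" where
  "eq2 A \<alpha> \<beta> \<longleftrightarrow> (\<forall>\<phi>\<in>A. \<forall>p\<in>fst \<phi>. \<forall>u v. \<alpha> \<phi> p u v = \<beta> \<phi> p u v)"

definition d0 :: "('m \<Rightarrow> 'w::real_normed_vector) \<Rightarrow> ('m, 'w) form1" where
  "d0 f \<phi> p u = frechet_derivative (f \<circ> chart_inv \<phi>) (at (snd \<phi> p)) u"

text \<open>The usual formula \<open>d\<omega>(X,Y) = X(\<omega>(Y)) - Y(\<omega>(X)) - \<omega>([X,Y])\<close> for the vector fields \<open>X\<close>, \<open>Y\<close>
  with constant coordinates \<open>u\<close>, \<open>v\<close> in the chart, which commute.\<close>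

definition d1 :: "('m, 'w::real_normed_vector) form1 \<Rightarrow> ('m, 'w) form2" where
  "d1 \<omega> \<phi> p u v = d0 (\<lambda>x. \<omega> \<phi> x v) \<phi> p u - d0 (\<lambda>x. \<omega> \<phi> x u) \<phi> p v"


section \<open>Conformal structure and its complex structure\<close>

type_synonym 'm metric = "'m chart \<Rightarrow> 'm \<Rightarrow> real^2 \<Rightarrow> real^2 \<Rightarrow> real"

definition riemannian_metric :: "'m chart set \<Rightarrow> 'm metric \<Rightarrow> bool" where
  "riemannian_metric A g \<longleftrightarrow>
     (\<forall>\<phi>\<in>A. \<forall>p\<in>fst \<phi>. bilinear (g \<phi> p) \<and> (\<forall>u v. g \<phi> p u v = g \<phi> p v u) \<and>
        (\<forall>u. u \<noteq> 0 \<longrightarrow> g \<phi> p u u > 0)) \<and>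
     (\<forall>\<phi>\<in>A. \<forall>\<psi>\<in>A. \<forall>p\<in>fst \<phi> \<inter> fst \<psi>. \<forall>u v.
        g \<phi> p u v = g \<psi> p (trans_diff \<phi> \<psi> p u) (trans_diff \<phi> \<psi> p v)) \<and>
     (\<forall>\<phi>\<in>A. \<forall>u v. smooth_on (snd \<phi> ` fst \<phi>) (\<lambda>x. g \<phi> (chart_inv \<phi> x) u v))"

definition conformal_to :: "'m chart set \<Rightarrow> 'm metric \<Rightarrow> 'm metric \<Rightarrow> bool" where
  "conformal_to A g g' \<longleftrightarrow> (\<exists>f::'m \<Rightarrow> real. smooth_map A f \<and> (\<forall>p. f p > 0) \<and>
     (\<forall>\<phi>\<in>A. \<forall>p\<in>fst \<phi>. \<forall>u v. g' \<phi> p u v = f p * g \<phi> p u v))"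

definition conformal_structure :: "'m chart set \<Rightarrow> 'm metric set \<Rightarrow> bool" where
  "conformal_structure A C \<longleftrightarrow> (\<exists>g. riemannian_metric A g \<and>
     C = {g'. riemannian_metric A g' \<and> conformal_to A g g'})"

text \<open>Rotation by a right angle in the positive direction. It is determined uniquely on every
  tangent space by the following conditions.\<close>

definition induced_complex_structure ::
  "'m chart set \<Rightarrow> 'm metric set \<Rightarrow> ('m, real^2) form1 \<Rightarrow> bool" where
  "induced_complex_structure A C J \<longleftrightarrow> (\<forall>\<phi>\<in>A. \<forall>p\<in>fst \<phi>.
     linear (J \<phi> p) \<and>
     (\<forall>u. J \<phi> p (J \<phi> p u) = - u) \<and>
     (\<forall>g\<in>C. \<forall>u v. g \<phi> p (J \<phi> p u) (J \<phi> p v) = g \<phi> p u v) \<and>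
     (\<forall>u. u \<noteq> 0 \<longrightarrow> det (vector [u, J \<phi> p u] :: real^2^2) > 0))"

definition star :: "('m, real^2) form1 \<Rightarrow> ('m, 'w::real_normed_vector) form1 \<Rightarrow> ('m, 'w) form1"
  where "star J \<omega> \<phi> p u = - \<omega> \<phi> p (J \<phi> p u)"


section \<open>Linear algebra of the complexified Lorentzian space\<close>

text \<open>The standard form with minus sign at the index \<open>t\<close>. For \<open>'a = real\<close> and \<open>CARD('k) = n + 2\<close> it
  is the metric of \<open>\<real>\<^sup>n\<^sup>+\<^sup>1\<^sup>,\<^sup>1\<close>, of signature \<open>(n + 1, 1)\<close>; for \<open>'a = complex\<close> it is the
  complex bilinear (not Hermitian) extension of the latter.\<close>

definition mform :: "'k::finite \<Rightarrow> 'a::comm_ring_1^'k \<Rightarrow> 'a^'k \<Rightarrow> 'a" where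
  "mform t v w = (\<Sum>i\<in>UNIV. (if i = t then - 1 else 1) * v $ i * w $ i)"

text \<open>Endomorphisms are matrices, acting by \<open>*v\<close>.\<close>

definition cscale :: "complex \<Rightarrow> complex^'k^'k \<Rightarrow> complex^'k^'k" where
  "cscale c B = map_matrix ((*) c) B"

definition lie :: "complex^'k::finite^'k \<Rightarrow> complex^'k^'k \<Rightarrow> complex^'k^'k" where
  "lie B B' = B ** B' - B' ** B"

definition wedge :: "'k::finite \<Rightarrow> complex^'k \<Rightarrow> complex^'k \<Rightarrow> complex^'k^'k" where
  "wedge t v\<^sub>1 v\<^sub>2 = matrix (\<lambda>w. mform t w v\<^sub>1 *s v\<^sub>2 - mform t w v\<^sub>2 *s v\<^sub>1)"

text \<open>\<open>span\<close> is the real span; since the generating set is closed under complex scaling when \<open>W\<close> is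
  a complex subspace, it is also the complex span.\<close>

definition wedge2 :: "'k::finite \<Rightarrow> (complex^'k) set \<Rightarrow> (complex^'k^'k) set" where
  "wedge2 t W = span {wedge t v\<^sub>1 v\<^sub>2 |v\<^sub>1 v\<^sub>2. v\<^sub>1 \<in> W \<and> v\<^sub>2 \<in> W}"

definition perp :: "'k::finite \<Rightarrow> (complex^'k) set \<Rightarrow> (complex^'k) set" where
  "perp t W = {w. \<forall>v\<in>W. mform t v w = 0}"

definition proj :: "'k::finite \<Rightarrow> (complex^'k) set \<Rightarrow> complex^'k \<Rightarrow> complex^'k" where
  "proj t W v = (THE w. w \<in> W \<and> v - w \<in> perp t W)"


section \<open>Subbundles of the trivial bundle\<close>

text \<open>A subbundle is given by its fibres; the rank is locally constant.\<close>

definition subbundle :: "'m::topological_space chart set \<Rightarrow> ('m \<Rightarrow> (complex^'k::finite) set) \<Rightarrow> bool"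
  where
  "subbundle A V \<longleftrightarrow> (\<forall>p. \<exists>U (r::nat) s. open U \<and> p \<in> U \<and>
     (\<forall>i<r. smooth_map_on A U (s i)) \<and>
     (\<forall>x\<in>U. inj_on (\<lambda>i. s i x) {..<r} \<and> vec.independent ((\<lambda>i. s i x) ` {..<r}) \<and>
        vec.span ((\<lambda>i. s i x) ` {..<r}) = V x))"

definition nondegenerate :: "'k::finite \<Rightarrow> ('m \<Rightarrow> (complex^'k) set) \<Rightarrow> bool" where
  "nondegenerate t V \<longleftrightarrow> (\<forall>p. \<forall>v\<in>V p. (\<forall>w\<in>V p. mform t v w = 0) \<longrightarrow> v = 0)"


section \<open>Connections on the trivial bundle\<close>

type_synonym ('m, 'k) bundle_section = "'m \<Rightarrow> complex^'k"
type_synonym ('m, 'k) operator = "('m, 'k) bundle_section \<Rightarrow> ('m, complex^'k) form1"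
type_synonym ('m, 'k) endform = "('m, complex^'k^'k) form1"

definition connection :: "'m chart set \<Rightarrow> ('m, 'k::finite) operator \<Rightarrow> bool" where
  "connection A D \<longleftrightarrow>
     (\<forall>s. smooth_map A s \<longrightarrow> one_form A (D s)) \<and>
     (\<forall>s s'. smooth_map A s \<longrightarrow> smooth_map A s' \<longrightarrow> (\<forall>\<phi>\<in>A. \<forall>p\<in>fst \<phi>. \<forall>u.
        D (\<lambda>x. s x + s' x) \<phi> p u = D s \<phi> p u + D s' \<phi> p u)) \<and>
     (\<forall>(f::'m \<Rightarrow> complex) s. smooth_map A f \<longrightarrow> smooth_map A s \<longrightarrow> (\<forall>\<phi>\<in>A. \<forall>p\<in>fst \<phi>. \<forall>u.
        D (\<lambda>x. f x *s s x) \<phi> p u = d0 f \<phi> p u *s s p + f p *s D s \<phi> p u))"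

definition metric_connection :: "'k::finite \<Rightarrow> 'm chart set \<Rightarrow> ('m, 'k) operator \<Rightarrow> bool" where
  "metric_connection t A D \<longleftrightarrow> connection A D \<and>
     (\<forall>s s'. smooth_map A s \<longrightarrow> smooth_map A s' \<longrightarrow> (\<forall>\<phi>\<in>A. \<forall>p\<in>fst \<phi>. \<forall>u.
        d0 (\<lambda>x. mform t (s x) (s' x)) \<phi> p u =
          mform t (D s \<phi> p u) (s' p) + mform t (s p) (D s' \<phi> p u)))"

text \<open>The endomorphism-valued form that agrees with an operator on constant sections. For a
  tensorial operator this is the operator itself; for a connection \<open>D\<close> it is the form \<open>B\<close> with
  \<open>D = d + B\<close>, where \<open>d\<close> is the trivial connection.\<close>

definition end_form :: "('m, 'k::finite) operator \<Rightarrow> ('m, 'k) endform" where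
  "end_form D \<phi> p u = matrix (\<lambda>v. D (\<lambda>_. v) \<phi> p u)"

text \<open>\<open>d\<^sup>D\<close> on section-valued 1-forms, i.e. \<open>d\<^sup>D\<omega>(X,Y) = D\<^sub>X(\<omega>(Y)) - D\<^sub>Y(\<omega>(X)) - \<omega>([X,Y])\<close>, written
  with \<open>D = d + B\<close>.\<close>

definition dcov :: "('m, 'k::finite) operator \<Rightarrow> ('m, complex^'k) form1 \<Rightarrow> ('m, complex^'k) form2"
  where
  "dcov D \<omega> \<phi> p u v = d1 \<omega> \<phi> p u v
     + (end_form D \<phi> p u *v \<omega> \<phi> p v - end_form D \<phi> p v *v \<omega> \<phi> p u)"

definition flat_connection :: "'m chart set \<Rightarrow> ('m, 'k::finite) operator \<Rightarrow> bool" where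
  "flat_connection A D \<longleftrightarrow> connection A D \<and>
     (\<forall>s. smooth_map A s \<longrightarrow> eq2 A (dcov D (D s)) (\<lambda>\<phi> p u v. 0))"

definition bracket_wedge :: "('m, 'k::finite) endform \<Rightarrow> ('m, 'k) endform \<Rightarrow>
    ('m, complex^'k^'k) form2" where
  "bracket_wedge \<mu> \<eta> \<phi> p u v = lie (\<mu> \<phi> p u) (\<eta> \<phi> p v) - lie (\<mu> \<phi> p v) (\<eta> \<phi> p u)"

text \<open>\<open>d\<^sup>D\<close> on endomorphism-valued 1-forms. The connection induced by \<open>D = d + B\<close> on endomorphisms,
  \<open>T \<mapsto> D \<circ> T - T \<circ> D\<close>, is \<open>d + [B, \<cdot>]\<close>.\<close>

definition dcov_End :: "('m, 'k::finite) operator \<Rightarrow> ('m, 'k) endform \<Rightarrow>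
    ('m, complex^'k^'k) form2" where
  "dcov_End D \<mu> \<phi> p u v = d1 \<mu> \<phi> p u v + bracket_wedge (end_form D) \<mu> \<phi> p u v"

definition part10 :: "('m, real^2) form1 \<Rightarrow> ('m, 'k::finite) endform \<Rightarrow> ('m, 'k) endform" where
  "part10 J \<mu> \<phi> p u = cscale (1/2) (\<mu> \<phi> p u - cscale \<i> (\<mu> \<phi> p (J \<phi> p u)))"

definition part01 :: "('m, real^2) form1 \<Rightarrow> ('m, 'k::finite) endform \<Rightarrow> ('m, 'k) endform" where
  "part01 J \<mu> \<phi> p u = cscale (1/2) (\<mu> \<phi> p u + cscale \<i> (\<mu> \<phi> p (J \<phi> p u)))"


section \<open>Constrained harmonic bundles\<close>

definition calD :: "'k::finite \<Rightarrow> ('m \<Rightarrow> (complex^'k) set) \<Rightarrow> ('m, 'k) operator \<Rightarrow> ('m, 'k) operator"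
  where
  "calD t V D s \<phi> p u =
     proj t (V p) (D (\<lambda>x. proj t (V x) (s x)) \<phi> p u) +
     proj t (perp t (V p)) (D (\<lambda>x. proj t (perp t (V x)) (s x)) \<phi> p u)"

definition calN :: "'k::finite \<Rightarrow> ('m \<Rightarrow> (complex^'k) set) \<Rightarrow> ('m, 'k) operator \<Rightarrow> ('m, 'k) endform"
  where
  "calN t V D = end_form (\<lambda>s \<phi> p u. D s \<phi> p u - calD t V D s \<phi> p u)"

definition constrained_harmonic :: "'k::finite \<Rightarrow> 'm chart set \<Rightarrow> ('m, real^2) form1 \<Rightarrow>
    ('m, 'k) endform \<Rightarrow> ('m, 'k) operator \<Rightarrow> ('m \<Rightarrow> (complex^'k) set) \<Rightarrow> bool" where
  "constrained_harmonic t A J q D V \<longleftrightarrow>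
     eq2 A (dcov_End (calD t V D) (part10 J q))
       (\<lambda>\<phi> p u v. cscale (1/2) (bracket_wedge q q \<phi> p u v)) \<and>
     eq2 A (dcov_End (calD t V D) (part01 J q))
       (\<lambda>\<phi> p u v. cscale (1/2) (bracket_wedge q q \<phi> p u v)) \<and>
     eq2 A (dcov_End (calD t V D) (star J (calN t V D)))
       (\<lambda>\<phi> p u v. cscale 2 (bracket_wedge q (star J (calN t V D)) \<phi> p u v))"

definition spectral_deformation :: "'k::finite \<Rightarrow> ('m, real^2) form1 \<Rightarrow> ('m, 'k) endform \<Rightarrow>
    ('m, 'k) operator \<Rightarrow> ('m \<Rightarrow> (complex^'k) set) \<Rightarrow> complex \<Rightarrow> ('m, 'k) operator" where
  "spectral_deformation t J q D V l s \<phi> p u = calD t V D s \<phi> p u +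
     (cscale (1 / l) (part10 J (calN t V D) \<phi> p u) +
      cscale l (part01 J (calN t V D) \<phi> p u) +
      cscale (1 / l^2 - 1) (part10 J q \<phi> p u) +
      cscale (l^2 - 1) (part01 J q \<phi> p u)) *v s p"

end

theory Submission
  imports Defs
begin

text \<open>Write \<open>\<D> = d + B\<close> for the part of the given connection preserving \<open>V\<close> and its complement, and
  \<open>N\<close> for the part exchanging them. Since the projection \<open>P\<close> onto \<open>V\<close> is \<open>\<D>\<close>-parallel, the curvature
  of \<open>\<D> + N\<close> splits into \<open>R\<^sup>\<D> + 1/2 [N \<and> N]\<close>, which commutes with \<open>P\<close>, and \<open>d\<^sup>\<D> N\<close>, which exchanges
  the summands, so flatness makes both vanish. There are no forms of type \<open>(2,0)\<close> or \<open>(0,2)\<close> on a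
  surface; hence the curvature of the connection with parameter \<open>\<lambda>\<close> reduces to
  \<open>(\<lambda>\<^sup>-\<^sup>2 - 1) X + (\<lambda>\<^sup>2 - 1) Y + (\<lambda>\<^sup>-\<^sup>1 - \<lambda>) Z\<close>, where \<open>X\<close> and \<open>Y\<close> measure the failure of the two
  equations in (i) and, as \<open>d\<^sup>\<D> N = 0\<close>, \<open>Z\<close> measures that of (ii). The three coefficient functions
  are linearly independent. All terms are globally smooth because \<open>P\<close> is given by the Gram matrix of a
  local frame and \<open>J\<close> by the coefficients of a metric in the conformal class.\<close>

section \<open>Smooth maps\<close>

text \<open>The given connection acts on global sections only, and both the orthogonal projection
  and \<open>J\<close> are prescribed pointwise, with no smoothness in their definitions. Each
  object is therefore turned into a smooth matrix-valued field: a connection becomes d plus the form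
  read off from constant sections, the projection becomes an idempotent field \<open>P\<close>, and
  what remains is matrix algebra with Leibniz rules. To identify flatness with the vanishing of a
  curvature matrix, second derivatives of smooth sections have to commute. No calculus argument is
  given for this. Flatness of the original connection, tested on constant sections and then on
  arbitrary ones, already contains it, and the same fact then serves \<open>P\<close> and every
  member of the spectral family.\<close>

lemma Ck_on_cong:
  assumes "open S" "\<And>x. x \<in> S \<Longrightarrow> f x = g x" "Ck_on S f k"
  shows "Ck_on S g k"
  using assms(2,3)
proof (induction k arbitrary: f g)
  case 0
  then show ?case by (simp cong: continuous_on_cong)
next
  case (Suc k)
  have d: "(g has_derivative frechet_derivative f (at x)) (at x)" if "x \<in> S" for x
    using Suc.prems that assms(1)
    by (auto simp: frechet_derivative_works intro: has_derivative_transform_within_open)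
  then have "frechet_derivative f (at x) = frechet_derivative g (at x)" if "x \<in> S" for x
    using frechet_derivative_at that by blast
  then have "Ck_on S (\<lambda>x. frechet_derivative g (at x) u) k" for u
    using Suc.prems(2)
    by (intro Suc.IH[of "\<lambda>x. frechet_derivative f (at x) u" "\<lambda>x. frechet_derivative g (at x) u"])
      simp_all
  then show ?case
    using d by (auto simp: differentiable_def)
qed

lemma Ck_on_local:
  assumes "\<And>x. x \<in> S \<Longrightarrow> \<exists>U. open U \<and> x \<in> U \<and> Ck_on U f k"
  shows "Ck_on S f k"
  using assms
proof (induction k arbitrary: f)
  case 0
  then show ?case
    by (metis Ck_on.simps(1) continuous_at_imp_continuous_on continuous_on_eq_continuous_at)
next
  case (Suc k)
  have "f differentiable (at x)" if "x \<in> S" for x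
    using Suc.prems[OF that] by auto
  moreover have "Ck_on S (\<lambda>x. frechet_derivative f (at x) u) k" for u
    using Suc.prems by (intro Suc.IH) fastforce
  ultimately show ?case by simp
qed

lemma Ck_on_SucD: "Ck_on S f (Suc k) \<Longrightarrow> Ck_on S f k"
proof (induction k arbitrary: f)
  case 0
  then show ?case
    by (auto intro!: continuous_at_imp_continuous_on differentiable_imp_continuous_within)
next
  case (Suc k)
  then show ?case by (metis Ck_on.simps(2))
qed

lemma Ck_on_const: "Ck_on S (\<lambda>x. c) k"
  by (induction k arbitrary: c) (auto simp: frechet_derivative_const)

text \<open>\<open>frechet_derivative\<close> is a choice term, so a candidate derivative is
  supplied instead; uniqueness of derivatives and openness of \<open>S\<close> transfer its order.
  The closure properties up to \<open>Ck_on_sqrt\<close> are inductions through this rule.\<close>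

lemma Ck_on_SucI:
  assumes "open S" "\<And>x. x \<in> S \<Longrightarrow> (f has_derivative f' x) (at x)" "\<And>u. Ck_on S (\<lambda>x. f' x u) k"
  shows "Ck_on S f (Suc k)"
proof -
  have "Ck_on S (\<lambda>x. frechet_derivative f (at x) u) k" for u
    using assms frechet_derivative_at by (intro Ck_on_cong[OF assms(1) _ assms(3)[of u]]) fastforce
  then show ?thesis
    using assms(2) by (auto simp: differentiable_def)
qed

lemma Ck_on_linear:
  assumes "open S" "bounded_linear h" "Ck_on S f k"
  shows "Ck_on S (\<lambda>x. h (f x)) k"
  using assms(3)
proof (induction k arbitrary: f)
  case 0
  then show ?case by (simp add: bounded_linear.continuous_on[OF assms(2)])
next
  case (Suc k)
  show ?case
    using Suc
    by (intro Ck_on_SucI[OF assms(1), where f' = "\<lambda>x u. h (frechet_derivative f (at x) u)"])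
      (auto intro!: bounded_linear.has_derivative[OF assms(2)] simp flip: frechet_derivative_works)
qed

lemma Ck_on_add:
  assumes "open S" "Ck_on S f k" "Ck_on S g k"
  shows "Ck_on S (\<lambda>x. f x + g x) k"
  using assms(2,3)
proof (induction k arbitrary: f g)
  case 0
  then show ?case by (simp add: continuous_on_add)
next
  case (Suc k)
  show ?case
    using Suc
    by (intro Ck_on_SucI[OF assms(1), where
          f' = "\<lambda>x u. frechet_derivative f (at x) u + frechet_derivative g (at x) u"])
      (auto intro!: has_derivative_add simp flip: frechet_derivative_works)
qed

lemma Ck_on_bilinear:
  assumes "open S" "bounded_bilinear h" "Ck_on S f k" "Ck_on S g k"
  shows "Ck_on S (\<lambda>x. h (f x) (g x)) k"
  using assms(3,4)
proof (induction k arbitrary: f g)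
  case 0
  then show ?case by (simp add: bounded_bilinear.continuous_on[OF assms(2)])
next
  case (Suc k)
  \<comment> \<open>The Leibniz rule leaves one factor undifferentiated, and that factor is needed
    at order k only.\<close>
  note low = Ck_on_SucD[OF Suc.prems(1)] Ck_on_SucD[OF Suc.prems(2)]
  show ?case
    using Suc
    by (intro Ck_on_SucI[OF assms(1), where
          f' = "\<lambda>x u. h (f x) (frechet_derivative g (at x) u) + h (frechet_derivative f (at x) u) (g x)"])
      (auto intro!: bounded_bilinear.FDERIV[OF assms(2)] Ck_on_add[OF assms(1)] Suc.IH low
        simp flip: frechet_derivative_works)
qed

text \<open>The derivative of 1/f is built from 1/f and the derivative of f, so the order already
  known for 1/f yields the next one. This is why f stays fixed in the induction.\<close>

lemma Ck_on_inverse: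
  fixes f :: "'a::euclidean_space \<Rightarrow> 'b::real_normed_field"
  assumes "open S" "Ck_on S f k" "\<And>x. x \<in> S \<Longrightarrow> f x \<noteq> 0"
  shows "Ck_on S (\<lambda>x. inverse (f x)) k"
  using assms(2)
proof (induction k)
  case 0
  then show ?case using assms(3) by (simp add: continuous_on_inverse)
next
  case (Suc k)
  have IH: "Ck_on S (\<lambda>x. inverse (f x)) k"
    using Suc Ck_on_SucD by blast
  have "Ck_on S (\<lambda>x. - (inverse (f x) * frechet_derivative f (at x) u * inverse (f x))) k" for u
    using Suc.prems
    by (intro Ck_on_linear[OF assms(1) bounded_linear_minus[OF bounded_linear_ident]]
        Ck_on_bilinear[OF assms(1) bounded_bilinear_mult] IH) simp
  then show ?case
    using Suc.prems assms(3)
    by (intro Ck_on_SucI[OF assms(1), where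
          f' = "\<lambda>x u. - (inverse (f x) * frechet_derivative f (at x) u * inverse (f x))"])
      (auto intro!: has_derivative_inverse' simp flip: frechet_derivative_works)
qed

text \<open>As for the inverse, the derivative f' / (2 sqrt f) contains the function itself at one
  order less. The square root is the one of the Gram determinant in \<open>rot90\<close>.\<close>

lemma Ck_on_sqrt:
  assumes "open S" "Ck_on S f k" "\<And>x. x \<in> S \<Longrightarrow> f x > 0"
  shows "Ck_on S (\<lambda>x. sqrt (f x)) k"
  using assms(2)
proof (induction k)
  case 0
  then show ?case by (simp add: continuous_on_real_sqrt)
next
  case (Suc k)
  have IH: "Ck_on S (\<lambda>x. sqrt (f x)) k"
    using Suc Ck_on_SucD by blast
  have "Ck_on S (\<lambda>x. frechet_derivative f (at x) u * (inverse (sqrt (f x)) * (1 / 2))) k" for u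
    using Suc.prems assms(3)
    by (intro Ck_on_bilinear[OF assms(1) bounded_bilinear_mult] Ck_on_inverse[OF assms(1)] IH
        Ck_on_const) (auto simp: less_le)
  moreover have "((\<lambda>x. sqrt (f x)) has_derivative
      (\<lambda>u. frechet_derivative f (at x) u * (inverse (sqrt (f x)) * (1 / 2)))) (at x)" if "x \<in> S" for x
    using has_derivative_real_sqrt[where g = f and x = x and s = UNIV and
        g' = "frechet_derivative f (at x)", OF assms(3)[OF that]] Suc.prems that
    by (simp add: field_simps frechet_derivative_works)
  ultimately show ?case
    by (intro Ck_on_SucI[OF assms(1)])
qed

lemma smooth_on_cong:
  "open S \<Longrightarrow> (\<And>x. x \<in> S \<Longrightarrow> f x = g x) \<Longrightarrow> smooth_on S f \<Longrightarrow> smooth_on S g"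
  unfolding smooth_on_def using Ck_on_cong by blast

text \<open>Meant for the orthogonal projection, whose explicit formula depends on a frame that
  exists only near each point.\<close>

lemma smooth_on_local:
  assumes "\<And>x. x \<in> S \<Longrightarrow> \<exists>U. open U \<and> x \<in> U \<and> smooth_on U f"
  shows "smooth_on S f"
  unfolding smooth_on_def by (intro allI Ck_on_local) (meson assms smooth_on_def)

lemma smooth_on_const: "smooth_on S (\<lambda>x. c)"
  by (simp add: smooth_on_def Ck_on_const)

lemma smooth_on_linear:
  "open S \<Longrightarrow> bounded_linear h \<Longrightarrow> smooth_on S f \<Longrightarrow> smooth_on S (\<lambda>x. h (f x))"
  by (simp add: smooth_on_def Ck_on_linear)

lemma smooth_on_add:
  "open S \<Longrightarrow> smooth_on S f \<Longrightarrow> smooth_on S g \<Longrightarrow> smooth_on S (\<lambda>x. f x + g x)"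
  by (simp add: smooth_on_def Ck_on_add)

lemma smooth_on_bilinear:
  "open S \<Longrightarrow> bounded_bilinear h \<Longrightarrow> smooth_on S f \<Longrightarrow> smooth_on S g \<Longrightarrow>
    smooth_on S (\<lambda>x. h (f x) (g x))"
  by (simp add: smooth_on_def Ck_on_bilinear)

lemma smooth_on_minus: "open S \<Longrightarrow> smooth_on S f \<Longrightarrow> smooth_on S (\<lambda>x. - f x)"
  by (rule smooth_on_linear[OF _ bounded_linear_minus[OF bounded_linear_ident]])

lemma smooth_on_diff:
  "open S \<Longrightarrow> smooth_on S f \<Longrightarrow> smooth_on S g \<Longrightarrow> smooth_on S (\<lambda>x. f x - g x)"
  using smooth_on_add[OF _ _ smooth_on_minus, of S f g] by simp

lemma smooth_on_mult:
  fixes f g :: "'a::euclidean_space \<Rightarrow> 'b::real_normed_algebra"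
  shows "open S \<Longrightarrow> smooth_on S f \<Longrightarrow> smooth_on S g \<Longrightarrow> smooth_on S (\<lambda>x. f x * g x)"
  by (rule smooth_on_bilinear[OF _ bounded_bilinear_mult])

lemma smooth_on_inverse:
  fixes f :: "'a::euclidean_space \<Rightarrow> 'b::real_normed_field"
  shows "open S \<Longrightarrow> smooth_on S f \<Longrightarrow> (\<And>x. x \<in> S \<Longrightarrow> f x \<noteq> 0) \<Longrightarrow> smooth_on S (\<lambda>x. inverse (f x))"
  by (simp add: smooth_on_def Ck_on_inverse)

lemma smooth_on_sqrt:
  "open S \<Longrightarrow> smooth_on S f \<Longrightarrow> (\<And>x. x \<in> S \<Longrightarrow> f x > 0) \<Longrightarrow> smooth_on S (\<lambda>x. sqrt (f x))"
  by (simp add: smooth_on_def Ck_on_sqrt)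

lemma smooth_on_sum:
  "open S \<Longrightarrow> (\<And>i. i \<in> I \<Longrightarrow> smooth_on S (f i)) \<Longrightarrow> smooth_on S (\<lambda>x. \<Sum>i\<in>I. f i x)"
  by (induction I rule: infinite_finite_induct) (auto intro: smooth_on_const smooth_on_add)

lemma smooth_on_prod:
  fixes f :: "'i \<Rightarrow> 'a::euclidean_space \<Rightarrow> 'b::real_normed_field"
  shows "open S \<Longrightarrow> (\<And>i. i \<in> I \<Longrightarrow> smooth_on S (f i)) \<Longrightarrow> smooth_on S (\<lambda>x. \<Prod>i\<in>I. f i x)"
  by (induction I rule: infinite_finite_induct) (auto intro: smooth_on_const smooth_on_mult)

lemma smooth_on_vec_nth:
  fixes f :: "'a::euclidean_space \<Rightarrow> 'b::real_normed_vector^'n"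
  shows "open S \<Longrightarrow> smooth_on S f \<Longrightarrow> smooth_on S (\<lambda>x. f x $ i)"
  by (rule smooth_on_linear[OF _ bounded_linear_vec_nth])

lemma bounded_linear_axis: "bounded_linear (axis i :: 'b::real_normed_vector \<Rightarrow> 'b^'n::finite)"
proof (rule bounded_linear_intro[where K = 1])
  show "norm (axis i x :: 'b^'n) \<le> norm x * 1" for x :: 'b
  proof -
    have "norm (axis i x :: 'b^'n) \<le> (\<Sum>j\<in>UNIV. norm ((axis i x :: 'b^'n) $ j))"
      unfolding norm_vec_def by (rule L2_set_le_sum) simp
    also have "\<dots> = (\<Sum>j\<in>UNIV. if j = i then norm x else 0)"
      by (intro sum.cong) (auto simp: axis_def)
    finally show ?thesis by simp
  qed
qed (auto simp: axis_def vec_eq_iff)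

lemma smooth_on_vec_lambda:
  fixes f :: "'n::finite \<Rightarrow> 'a::euclidean_space \<Rightarrow> 'b::real_normed_vector"
  assumes "open S" "\<And>i. smooth_on S (f i)"
  shows "smooth_on S (\<lambda>x. \<chi> i. f i x)"
proof -
  have "(\<chi> i. f i x) = (\<Sum>i\<in>UNIV. axis i (f i x))" for x
    by (auto simp: vec_eq_iff axis_def if_distrib cong: if_cong)
  then show ?thesis
    using assms by (auto intro!: smooth_on_sum smooth_on_linear[OF _ bounded_linear_axis])
qed

lemma smooth_on_derivative:
  "smooth_on S f \<Longrightarrow> smooth_on S (\<lambda>x. frechet_derivative f (at x) u)"
  unfolding smooth_on_def by (metis Ck_on.simps(2))

lemma smooth_on_differentiable: "smooth_on S f \<Longrightarrow> x \<in> S \<Longrightarrow> f differentiable (at x)"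
  unfolding smooth_on_def by (metis Ck_on.simps(2))

lemma smooth_on_det:
  fixes f :: "'a::euclidean_space \<Rightarrow> 'b::real_normed_field^'n::finite^'n"
  assumes "open S" "\<And>i j. smooth_on S (\<lambda>x. f x $ i $ j)"
  shows "smooth_on S (\<lambda>x. det (f x))"
  unfolding det_def
  using assms by (intro smooth_on_sum smooth_on_mult smooth_on_const smooth_on_prod)


section \<open>Differential forms and the complex structure of a surface\<close>

abbreviation coord :: "'m chart \<Rightarrow> (real^2) set" where
  "coord \<phi> \<equiv> snd \<phi> ` fst \<phi>"

abbreviation chart_differentiable ::
  "'m chart \<Rightarrow> 'm \<Rightarrow> ('m \<Rightarrow> 'w::real_normed_vector) \<Rightarrow> bool" where
  "chart_differentiable \<phi> p f \<equiv> (f \<circ> chart_inv \<phi>) differentiable (at (snd \<phi> p))"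

lemma d0_const [simp]: "d0 (\<lambda>x. c) \<phi> p u = 0"
  by (simp add: d0_def o_def frechet_derivative_const)

lemma has_derivative_d0:
  "chart_differentiable \<phi> p f \<Longrightarrow> (f \<circ> chart_inv \<phi> has_derivative d0 f \<phi> p) (at (snd \<phi> p))"
  unfolding d0_def frechet_derivative_works by simp

lemma d0_eqI:
  "(f \<circ> chart_inv \<phi> has_derivative F) (at (snd \<phi> p)) \<Longrightarrow> d0 f \<phi> p u = F u"
  unfolding d0_def by (metis frechet_derivative_at)

lemma d0_bounded_linear:
  assumes "bounded_linear h" "chart_differentiable \<phi> p f"
  shows "d0 (\<lambda>x. h (f x)) \<phi> p u = h (d0 f \<phi> p u)"
  using bounded_linear.has_derivative[OF assms(1) has_derivative_d0[OF assms(2)]]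
  by (intro d0_eqI[where F = "\<lambda>u. h (d0 f \<phi> p u)"]) (simp add: o_def)

lemma d0_add:
  assumes "chart_differentiable \<phi> p f" "chart_differentiable \<phi> p g"
  shows "d0 (\<lambda>x. f x + g x) \<phi> p u = d0 f \<phi> p u + d0 g \<phi> p u"
  using has_derivative_add[OF has_derivative_d0[OF assms(1)] has_derivative_d0[OF assms(2)]]
  by (intro d0_eqI[where F = "\<lambda>u. d0 f \<phi> p u + d0 g \<phi> p u"]) (simp add: o_def)

lemma d0_diff:
  assumes "chart_differentiable \<phi> p f" "chart_differentiable \<phi> p g"
  shows "d0 (\<lambda>x. f x - g x) \<phi> p u = d0 f \<phi> p u - d0 g \<phi> p u"
  using has_derivative_diff[OF has_derivative_d0[OF assms(1)] has_derivative_d0[OF assms(2)]]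
  by (intro d0_eqI[where F = "\<lambda>u. d0 f \<phi> p u - d0 g \<phi> p u"]) (simp add: o_def)

section \<open>Functions and forms in the charts of an oriented surface\<close>

context
  fixes A :: "('m::{t2_space,second_countable_topology}) chart set"
  assumes A: "oriented_surface A"
begin

lemma open_coord: "\<phi> \<in> A \<Longrightarrow> open (coord \<phi>)"
  using A by (auto simp: oriented_surface_def)

lemma chart_homeomorphism:
  "\<phi> \<in> A \<Longrightarrow> homeomorphism (fst \<phi>) (coord \<phi>) (snd \<phi>) (chart_inv \<phi>)"
  using A by (auto simp: oriented_surface_def)

lemma chart_inv_coord: "\<phi> \<in> A \<Longrightarrow> p \<in> fst \<phi> \<Longrightarrow> chart_inv \<phi> (snd \<phi> p) = p"
  using chart_homeomorphism homeomorphism_apply1 by fastforce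

lemma chart_inv_in: "x \<in> coord \<phi> \<Longrightarrow> chart_inv \<phi> x \<in> fst \<phi>"
  by (rule inv_into_into)

lemma coord_chart_inv: "x \<in> coord \<phi> \<Longrightarrow> snd \<phi> (chart_inv \<phi> x) = x"
  by (rule f_inv_into_f)

lemma open_coord_image:
  assumes "\<phi> \<in> A" "open U"
  shows "open (snd \<phi> ` (fst \<phi> \<inter> U))"
proof -
  have "snd \<phi> ` (fst \<phi> \<inter> U) = coord \<phi> \<inter> chart_inv \<phi> -` U"
    using chart_inv_coord[OF assms(1)] by (auto simp: chart_inv_in)
  moreover have "continuous_on (coord \<phi>) (chart_inv \<phi>)"
    using chart_homeomorphism[OF assms(1)] by (simp add: homeomorphism_def)
  ultimately show ?thesis
    using continuous_open_preimage open_coord[OF assms(1)] assms(2) by metis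
qed

text \<open>The two derivatives are choices from predicates that coincide, because the chart has an
  open image. This allows an identity between chart-dependent expressions to be differentiated
  inside that chart.\<close>

lemma d0_cong:
  assumes "\<phi> \<in> A" "p \<in> fst \<phi>" "\<And>x. x \<in> fst \<phi> \<Longrightarrow> f x = g x"
  shows "d0 f \<phi> p = d0 g \<phi> p"
proof -
  have "(f \<circ> chart_inv \<phi> has_derivative F) (at (snd \<phi> p)) \<longleftrightarrow>
      (g \<circ> chart_inv \<phi> has_derivative F) (at (snd \<phi> p))" for F
    using assms open_coord[OF assms(1)]
    by (intro iffI; elim has_derivative_transform_within_open) (auto simp: chart_inv_in)
  then show ?thesis
    by (auto simp: d0_def frechet_derivative_def)
qed

lemma d0_bilinear:
  assumes "bounded_bilinear h" "\<phi> \<in> A" "p \<in> fst \<phi>"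
    "chart_differentiable \<phi> p f" "chart_differentiable \<phi> p g"
  shows "d0 (\<lambda>x. h (f x) (g x)) \<phi> p u = h (f p) (d0 g \<phi> p u) + h (d0 f \<phi> p u) (g p)"
  using bounded_bilinear.FDERIV[OF assms(1) has_derivative_d0[OF assms(4)] has_derivative_d0[OF assms(5)]]
    chart_inv_coord[OF assms(2,3)]
  by (intro d0_eqI[where F = "\<lambda>u. h (f p) (d0 g \<phi> p u) + h (d0 f \<phi> p u) (g p)"])
    (simp add: o_def)

lemma smooth_map_iff:
  "smooth_map A f \<longleftrightarrow> (\<forall>\<phi>\<in>A. smooth_on (coord \<phi>) (\<lambda>x. f (chart_inv \<phi> x)))"
  by (simp add: smooth_map_on_def o_def)

lemma smooth_map_differentiable:
  "smooth_map A f \<Longrightarrow> \<phi> \<in> A \<Longrightarrow> p \<in> fst \<phi> \<Longrightarrow> chart_differentiable \<phi> p f"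
  by (auto simp: smooth_map_on_def intro: smooth_on_differentiable)

lemma smooth_map_d0_differentiable:
  assumes "smooth_map A f" "\<phi> \<in> A" "p \<in> fst \<phi>"
  shows "chart_differentiable \<phi> p (\<lambda>x. d0 f \<phi> x u)"
proof -
  have "smooth_on (coord \<phi>) (f \<circ> chart_inv \<phi>)"
    using assms by (simp add: smooth_map_on_def)
  then have "smooth_on (coord \<phi>) ((\<lambda>x. d0 f \<phi> x u) \<circ> chart_inv \<phi>)"
    by (rule smooth_on_cong[OF open_coord[OF assms(2)] _ smooth_on_derivative[where u = u], rotated])
      (simp add: d0_def coord_chart_inv)
  then show ?thesis
    using assms(3) by (auto intro: smooth_on_differentiable)
qed

lemma smooth_map_const: "smooth_map A (\<lambda>x. c)"
  by (simp add: smooth_map_iff smooth_on_const)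

lemma smooth_map_linear: "bounded_linear h \<Longrightarrow> smooth_map A f \<Longrightarrow> smooth_map A (\<lambda>x. h (f x))"
  unfolding smooth_map_iff by (intro ballI, rule smooth_on_linear[OF open_coord, where h = h]) simp_all

lemma smooth_map_bilinear:
  "bounded_bilinear h \<Longrightarrow> smooth_map A f \<Longrightarrow> smooth_map A g \<Longrightarrow> smooth_map A (\<lambda>x. h (f x) (g x))"
  unfolding smooth_map_iff by (intro ballI, rule smooth_on_bilinear[OF open_coord, where h = h]) simp_all

lemma smooth_map_add: "smooth_map A f \<Longrightarrow> smooth_map A g \<Longrightarrow> smooth_map A (\<lambda>x. f x + g x)"
  unfolding smooth_map_iff by (intro ballI, rule smooth_on_add[OF open_coord]) simp_all

lemma smooth_map_diff: "smooth_map A f \<Longrightarrow> smooth_map A g \<Longrightarrow> smooth_map A (\<lambda>x. f x - g x)"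
  unfolding smooth_map_iff by (intro ballI, rule smooth_on_diff[OF open_coord]) simp_all

lemma one_form_linear: "one_form A \<omega> \<Longrightarrow> \<phi> \<in> A \<Longrightarrow> p \<in> fst \<phi> \<Longrightarrow> linear (\<omega> \<phi> p)"
  by (simp add: one_form_def)

lemma one_form_differentiable:
  "one_form A \<omega> \<Longrightarrow> \<phi> \<in> A \<Longrightarrow> p \<in> fst \<phi> \<Longrightarrow> chart_differentiable \<phi> p (\<lambda>x. \<omega> \<phi> x u)"
  unfolding one_form_def o_def by (blast intro: smooth_on_differentiable imageI)

lemma one_form_trans:
  "one_form A \<omega> \<Longrightarrow> \<phi> \<in> A \<Longrightarrow> \<psi> \<in> A \<Longrightarrow> p \<in> fst \<phi> \<inter> fst \<psi> \<Longrightarrow>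
    \<omega> \<psi> p (trans_diff \<phi> \<psi> p u) = \<omega> \<phi> p u"
  unfolding one_form_def by metis

lemma one_form_smooth:
  "one_form A \<omega> \<Longrightarrow> \<phi> \<in> A \<Longrightarrow> smooth_on (coord \<phi>) (\<lambda>x. \<omega> \<phi> (chart_inv \<phi> x) u)"
  unfolding one_form_def by blast

lemma one_formI:
  assumes "\<And>\<phi> p. \<phi> \<in> A \<Longrightarrow> p \<in> fst \<phi> \<Longrightarrow> linear (\<omega> \<phi> p)"
    and "\<And>\<phi> \<psi> p u. \<phi> \<in> A \<Longrightarrow> \<psi> \<in> A \<Longrightarrow> p \<in> fst \<phi> \<inter> fst \<psi> \<Longrightarrow>
      \<omega> \<psi> p (trans_diff \<phi> \<psi> p u) = \<omega> \<phi> p u"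
    and "\<And>\<phi> u. \<phi> \<in> A \<Longrightarrow> smooth_on (coord \<phi>) (\<lambda>x. \<omega> \<phi> (chart_inv \<phi> x) u)"
  shows "one_form A \<omega>"
  unfolding one_form_def using assms by metis

lemma one_form_bounded_linear:
  assumes "bounded_linear h" "one_form A \<omega>"
  shows "one_form A (\<lambda>\<phi> p u. h (\<omega> \<phi> p u))"
proof (rule one_formI)
  show "linear (\<lambda>u. h (\<omega> \<phi> p u))" if "\<phi> \<in> A" "p \<in> fst \<phi>" for \<phi> p
    using linear_compose[OF one_form_linear[OF assms(2) that] bounded_linear.linear[OF assms(1)]]
    by (simp add: o_def)
  show "smooth_on (coord \<phi>) (\<lambda>x. h (\<omega> \<phi> (chart_inv \<phi> x) u))" if "\<phi> \<in> A" for \<phi> u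
    by (rule smooth_on_linear[OF open_coord[OF that] assms(1) one_form_smooth[OF assms(2) that]])
qed (simp add: one_form_trans[OF assms(2)])

lemma one_form_add:
  assumes "one_form A \<omega>" "one_form A \<eta>"
  shows "one_form A (\<lambda>\<phi> p u. \<omega> \<phi> p u + \<eta> \<phi> p u)"
proof (rule one_formI)
  show "linear (\<lambda>u. \<omega> \<phi> p u + \<eta> \<phi> p u)" if "\<phi> \<in> A" "p \<in> fst \<phi>" for \<phi> p
    by (rule linear_compose_add[OF one_form_linear[OF assms(1) that] one_form_linear[OF assms(2) that]])
  show "smooth_on (coord \<phi>) (\<lambda>x. \<omega> \<phi> (chart_inv \<phi> x) u + \<eta> \<phi> (chart_inv \<phi> x) u)"
    if "\<phi> \<in> A" for \<phi> u
    by (rule smooth_on_add[OF open_coord[OF that] one_form_smooth[OF assms(1) that]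
          one_form_smooth[OF assms(2) that]])
qed (simp add: one_form_trans[OF assms(1)] one_form_trans[OF assms(2)])

lemma one_form_diff:
  assumes "one_form A \<omega>" "one_form A \<eta>"
  shows "one_form A (\<lambda>\<phi> p u. \<omega> \<phi> p u - \<eta> \<phi> p u)"
  using one_form_add[OF assms(1) one_form_bounded_linear[OF
        bounded_linear_minus[OF bounded_linear_ident] assms(2)]] by simp

lemma one_form_bilinear:
  assumes "bounded_bilinear h" "smooth_map A f" "one_form A \<omega>"
  shows "one_form A (\<lambda>\<phi> p u. h (f p) (\<omega> \<phi> p u))"
proof (rule one_formI)
  interpret bounded_bilinear h by fact
  show "linear (\<lambda>u. h (f p) (\<omega> \<phi> p u))" if "\<phi> \<in> A" "p \<in> fst \<phi>" for \<phi> p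
    using linear_compose[OF one_form_linear[OF assms(3) that] bounded_linear.linear[OF bounded_linear_right]]
    by (simp add: o_def)
  show "smooth_on (coord \<phi>) (\<lambda>x. h (f (chart_inv \<phi> x)) (\<omega> \<phi> (chart_inv \<phi> x) u))"
    if "\<phi> \<in> A" for \<phi> u
    using assms(2) that unfolding smooth_map_iff
    by (intro smooth_on_bilinear[OF open_coord[OF that] assms(1) _ one_form_smooth[OF assms(3) that]]) blast
qed (simp add: one_form_trans[OF assms(3)])

text \<open>Orientation enters here: the determinant of a pair of vectors is multiplied by that of
  the transition Jacobian, which is positive in an oriented atlas. Hence the sign condition on
  \<open>J\<close> does not depend on the chart.\<close>

lemma trans_diff_props:
  assumes "\<phi> \<in> A" "\<psi> \<in> A" "p \<in> fst \<phi> \<inter> fst \<psi>"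
  shows "linear (trans_diff \<phi> \<psi> p)"
    and "det (vector [trans_diff \<phi> \<psi> p u, trans_diff \<phi> \<psi> p w] :: real^2^2) > 0 \<longleftrightarrow>
      det (vector [u, w] :: real^2^2) > 0"
proof -
  let ?f = "chart_trans \<phi> \<psi>" and ?x = "snd \<phi> p"
  have x: "?x \<in> snd \<phi> ` (fst \<phi> \<inter> fst \<psi>)" using assms by auto
  have d: "?f differentiable (at ?x)"
    using A assms x unfolding oriented_surface_def by (blast intro: smooth_on_differentiable)
  let ?M = "jacobian ?f (at ?x)"
  have T: "trans_diff \<phi> \<psi> p = (*v) ?M"
    using d jacobian_works frechet_derivative_at unfolding trans_diff_def by fastforce
  then show "linear (trans_diff \<phi> \<psi> p)" by simp
  have "det ?M > 0"
    using A assms x unfolding oriented_surface_def by blast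
  moreover have "det (vector [trans_diff \<phi> \<psi> p u, trans_diff \<phi> \<psi> p w] :: real^2^2)
      = det ?M * det (vector [u, w] :: real^2^2)"
    by (simp add: T det_2 matrix_vector_mult_def UNIV_2 algebra_simps)
  ultimately show "det (vector [trans_diff \<phi> \<psi> p u, trans_diff \<phi> \<psi> p w] :: real^2^2) > 0 \<longleftrightarrow>
      det (vector [u, w] :: real^2^2) > 0"
    by (simp add: zero_less_mult_iff)
qed

end

text \<open>The rotation by a right angle for the inner product with matrix \<open>(a, b; b, c)\<close>.\<close>

definition rot90 :: "real \<Rightarrow> real \<Rightarrow> real \<Rightarrow> real^2 \<Rightarrow> real^2" where
  "rot90 a b c u = inverse (sqrt (a * c - b * b)) *\<^sub>R
     vector [- (b * u $ 1 + c * u $ 2), a * u $ 1 + b * u $ 2]"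

text \<open>Orthogonality of u and w together with u1 w2 - u2 w1 = d is a linear system for w whose
  determinant is m, the squared length of u. Cramer's rule makes w the multiple k = d / m of an
  explicit vector; equality of lengths gives k^2 (ac - b^2) = 1, and d > 0 selects the positive
  root.\<close>

lemma rot90_unique_aux:
  fixes a b c u1 u2 w1 w2 :: real
  assumes "a * c - b * b > 0"
    and m: "a * u1 * u1 + 2 * b * u1 * u2 + c * u2 * u2 > 0"
    and o: "a * u1 * w1 + b * (u1 * w2 + u2 * w1) + c * u2 * w2 = 0"
    and n: "a * w1 * w1 + 2 * b * w1 * w2 + c * w2 * w2 =
      a * u1 * u1 + 2 * b * u1 * u2 + c * u2 * u2"
    and d: "u1 * w2 - u2 * w1 > 0"
  shows "w1 = inverse (sqrt (a * c - b * b)) * - (b * u1 + c * u2)"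
    and "w2 = inverse (sqrt (a * c - b * b)) * (a * u1 + b * u2)"
proof -
  define m where "m = a * u1 * u1 + 2 * b * u1 * u2 + c * u2 * u2"
  define d where "d = u1 * w2 - u2 * w1"
  define k where "k = d / m"
  have m0: "m > 0" and d0: "d > 0" using assms by (simp_all add: m_def d_def)
  then have k0: "k > 0" by (simp add: k_def)
  have "m * w1 = - (b * u1 + c * u2) * d"
    using o unfolding m_def d_def by algebra
  then have w1: "w1 = k * - (b * u1 + c * u2)"
    using m0 by (simp add: k_def field_simps)
  have "m * w2 = (a * u1 + b * u2) * d"
    using o unfolding m_def d_def by algebra
  then have w2: "w2 = k * (a * u1 + b * u2)"
    using m0 by (simp add: k_def field_simps)
  have "a * w1 * w1 + 2 * b * w1 * w2 + c * w2 * w2 = k * k * (a * c - b * b) * m"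
    unfolding w1 w2 m_def by algebra
  then have "k * k * (a * c - b * b) = 1"
    using n m0 by (simp add: m_def)
  then have "(a * c - b * b) = (inverse k)\<^sup>2"
    using k0 by (simp add: field_simps power2_eq_square)
  then have "sqrt (a * c - b * b) = inverse k"
    using k0 by (simp add: real_sqrt_unique)
  then show "w1 = inverse (sqrt (a * c - b * b)) * - (b * u1 + c * u2)"
    and "w2 = inverse (sqrt (a * c - b * b)) * (a * u1 + b * u2)"
    using w1 w2 by simp_all
qed

lemma inner_product_2:
  fixes G :: "real^2 \<Rightarrow> real^2 \<Rightarrow> real"
  assumes "bilinear G" and sym: "\<And>u v. G u v = G v u"
  defines "a \<equiv> G (axis 1 1) (axis 1 1)" and "b \<equiv> G (axis 1 1) (axis 2 1)"
    and "c \<equiv> G (axis 2 1) (axis 2 1)"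
  shows "G u w = a * u $ 1 * w $ 1 + b * (u $ 1 * w $ 2 + u $ 2 * w $ 1) + c * u $ 2 * w $ 2"
proof -
  have e: "v = v $ 1 *\<^sub>R axis 1 1 + v $ 2 *\<^sub>R axis 2 1" for v :: "real^2"
    by (simp add: vec_eq_iff axis_def forall_2)
  show ?thesis
    using assms(1) unfolding a_def b_def c_def
    by (subst e[of u], subst e[of w])
      (simp add: bilinear_ladd bilinear_radd bilinear_lmul bilinear_rmul algebra_simps
        sym[of "axis 2 1" "axis 1 1"])
qed

lemma gram_det_pos:
  fixes G :: "real^2 \<Rightarrow> real^2 \<Rightarrow> real"
  assumes "bilinear G" "\<And>u v. G u v = G v u" and pos: "\<And>u. u \<noteq> 0 \<Longrightarrow> G u u > 0"
  shows "G (axis 1 1) (axis 1 1) * G (axis 2 1) (axis 2 1)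
    - G (axis 1 1) (axis 2 1) * G (axis 1 1) (axis 2 1) > 0"
proof -
  let ?a = "G (axis 1 1) (axis 1 1)" and ?b = "G (axis 1 1) (axis 2 1)"
    and ?c = "G (axis 2 1) (axis 2 1)"
  have a: "?a > 0" by (rule pos) (simp add: axis_eq_0_iff)
  \<comment> \<open>This vector is orthogonal to the first axis and has squared length a (ac -
    b^2).\<close>
  then have "(vector [- ?b, ?a] :: real^2) \<noteq> 0"
    by (auto simp: vec_eq_iff forall_2)
  from pos[OF this] have "?a * (?a * ?c - ?b * ?b) > 0"
    by (simp add: inner_product_2[OF assms(1,2), of "vector [- ?b, ?a]" "vector [- ?b, ?a]"] algebra_simps)
  then show ?thesis using a by (simp add: zero_less_mult_iff)
qed

lemma rot90_unique:
  fixes G :: "real^2 \<Rightarrow> real^2 \<Rightarrow> real"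
  assumes "bilinear G" "\<And>u v. G u v = G v u" and pos: "\<And>u. u \<noteq> 0 \<Longrightarrow> G u u > 0"
    and "G u w = 0" "G w w = G u u" "det (vector [u, w] :: real^2^2) > 0"
  shows "w = rot90 (G (axis 1 1) (axis 1 1)) (G (axis 1 1) (axis 2 1)) (G (axis 2 1) (axis 2 1)) u"
proof -
  have "u \<noteq> 0" using assms(6) by (auto simp: det_2)
  then have "G u u > 0" by (rule pos)
  note e = inner_product_2[OF assms(1,2), of u u] inner_product_2[OF assms(1,2), of u w]
    inner_product_2[OF assms(1,2), of w w]
  note r = rot90_unique_aux[OF gram_det_pos[OF assms(1-3)], of "u $ 1" "u $ 2" "w $ 1" "w $ 2"]
  show ?thesis
    unfolding rot90_def vec_eq_iff forall_2 vector_scaleR_component vector_2 real_scaleR_def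
    by (intro conjI r) (use \<open>G u u > 0\<close> assms(4-6) in \<open>simp_all add: e det_2 algebra_simps\<close>)
qed

text \<open>An isometry with square -1 satisfies G u (j u) = G (j u) (-u) = - G u (j u). So
  \<open>j u\<close> is orthogonal to \<open>u\<close>, of the same length and on the positive side,
  and \<open>rot90_unique\<close> leaves one such vector.\<close>

lemma complex_structure_rot90:
  fixes G :: "real^2 \<Rightarrow> real^2 \<Rightarrow> real"
  assumes G: "bilinear G" "\<And>u v. G u v = G v u" "\<And>u. u \<noteq> 0 \<Longrightarrow> G u u > 0"
    and j: "linear j" "\<And>u. j (j u) = - u" "\<And>u v. G (j u) (j v) = G u v"
      "\<And>u. u \<noteq> 0 \<Longrightarrow> det (vector [u, j u] :: real^2^2) > 0"
  shows "j u = rot90 (G (axis 1 1) (axis 1 1)) (G (axis 1 1) (axis 2 1)) (G (axis 2 1) (axis 2 1)) u"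
proof (cases "u = 0")
  case True
  show ?thesis
    unfolding True linear_0[OF j(1)] by (simp add: rot90_def vec_eq_iff forall_2)
next
  case False
  have "G u (j u) = G (j u) (- u)" using j(3)[of u "j u"] j(2) by simp
  then have "G u (j u) = 0" using G(2)[of u "j u"] bilinear_rneg[OF G(1), of "j u" u] by simp
  then show ?thesis
    using G j False by (intro rot90_unique) auto
qed

section \<open>Smoothness and chart independence of the complex structure\<close>

context
  fixes A :: "('m::{t2_space,second_countable_topology}) chart set" and C J
  assumes A: "oriented_surface A" and C: "conformal_structure A C"
    and J: "induced_complex_structure A C J"
begin

lemma J_linear: "\<phi> \<in> A \<Longrightarrow> p \<in> fst \<phi> \<Longrightarrow> linear (J \<phi> p)"
  and J_J: "\<phi> \<in> A \<Longrightarrow> p \<in> fst \<phi> \<Longrightarrow> J \<phi> p (J \<phi> p u) = - u"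
  and J_det: "\<phi> \<in> A \<Longrightarrow> p \<in> fst \<phi> \<Longrightarrow> u \<noteq> 0 \<Longrightarrow> det (vector [u, J \<phi> p u] :: real^2^2) > 0"
  using J by (auto simp: induced_complex_structure_def)

text \<open>The conformal factor 1 puts the metric generating the class into the class itself, so
  \<open>J\<close> is an isometry for it.\<close>

lemma ex_metric:
  obtains g where "riemannian_metric A g"
    "\<And>\<phi> p u v. \<phi> \<in> A \<Longrightarrow> p \<in> fst \<phi> \<Longrightarrow> g \<phi> p (J \<phi> p u) (J \<phi> p v) = g \<phi> p u v"
proof -
  obtain g where g: "riemannian_metric A g" "C = {g'. riemannian_metric A g' \<and> conformal_to A g g'}"
    using C by (auto simp: conformal_structure_def)
  have "conformal_to A g g"
    unfolding conformal_to_def by (rule exI[of _ "\<lambda>_. 1"]) (simp add: smooth_map_const[OF A])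
  with g J that show ?thesis by (auto simp: induced_complex_structure_def)
qed

text \<open>The conditions defining \<open>J\<close> are pointwise; smoothness comes from the
  formula \<open>rot90\<close>, whose entries are the smooth coefficients of a metric and whose
  square root has a positive argument.\<close>

lemma J_smooth:
  assumes "\<phi> \<in> A"
  shows "smooth_on (coord \<phi>) (\<lambda>x. J \<phi> (chart_inv \<phi> x) u)"
proof -
  obtain g where g: "riemannian_metric A g"
    "\<And>\<phi> p u v. \<phi> \<in> A \<Longrightarrow> p \<in> fst \<phi> \<Longrightarrow> g \<phi> p (J \<phi> p u) (J \<phi> p v) = g \<phi> p u v"
    using ex_metric by blast
  let ?g = "\<lambda>i j x. g \<phi> (chart_inv \<phi> x) (axis i 1) (axis j 1)"
  have G: "bilinear (g \<phi> p)" "\<And>u v. g \<phi> p u v = g \<phi> p v u" "\<And>u. u \<noteq> 0 \<Longrightarrow> g \<phi> p u u > 0"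
    if "p \<in> fst \<phi>" for p
    using g(1) assms that unfolding riemannian_metric_def by blast+
  have s: "smooth_on (coord \<phi>) (?g i j)" for i j
    using g(1) assms unfolding riemannian_metric_def by blast
  have eq: "J \<phi> (chart_inv \<phi> x) u = rot90 (?g 1 1 x) (?g 1 2 x) (?g 2 2 x) u" if "x \<in> coord \<phi>" for x
    using that assms
    by (intro complex_structure_rot90 G g(2) J_linear J_J J_det) (auto simp: chart_inv_in[OF A])
  have pos: "?g 1 1 x * ?g 2 2 x - ?g 1 2 x * ?g 1 2 x > 0" if "x \<in> coord \<phi>" for x
    using gram_det_pos[OF G[OF chart_inv_in[OF A that]]] .
  have vec: "(vector [y, z] :: real^2) = (\<chi> i. if i = 1 then y else z)" for y z
    by (simp add: vec_eq_iff forall_2)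
  note o = open_coord[OF A assms]
  have "smooth_on (coord \<phi>) (\<lambda>x. rot90 (?g 1 1 x) (?g 1 2 x) (?g 2 2 x) u)"
    unfolding rot90_def vec
  proof (intro smooth_on_bilinear[OF o bounded_bilinear_scaleR] smooth_on_inverse[OF o]
      smooth_on_sqrt[OF o] smooth_on_vec_lambda[OF o])
    show "smooth_on (coord \<phi>) (\<lambda>x. ?g 1 1 x * ?g 2 2 x - ?g 1 2 x * ?g 1 2 x)"
      by (intro smooth_on_diff[OF o] smooth_on_mult[OF o] s)
    show "smooth_on (coord \<phi>) (\<lambda>x. if i = 1 then - (?g 1 2 x * u $ 1 + ?g 2 2 x * u $ 2)
        else ?g 1 1 x * u $ 1 + ?g 1 2 x * u $ 2)" for i :: 2
      by (cases "i = 1") (auto intro!: smooth_on_minus[OF o] smooth_on_add[OF o]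
          smooth_on_diff[OF o] smooth_on_mult[OF o] s smooth_on_const)
  qed (use pos in \<open>auto simp: less_le\<close>)
  then show ?thesis
    by (rule smooth_on_cong[OF o, rotated]) (simp add: eq)
qed

text \<open>The transition differential is an isometry and preserves orientation. Hence both sides
  are the positive rotation by a right angle of the same vector, and this rotation is
  unique.\<close>

lemma J_trans:
  assumes "\<phi> \<in> A" "\<psi> \<in> A" "p \<in> fst \<phi> \<inter> fst \<psi>"
  shows "J \<psi> p (trans_diff \<phi> \<psi> p u) = trans_diff \<phi> \<psi> p (J \<phi> p u)"
proof (cases "u = 0")
  case True
  have "linear (J \<psi> p)" "linear (J \<phi> p)" using J_linear assms by auto
  then show ?thesis using True trans_diff_props(1)[OF A assms] by (simp add: linear_0)
next
  case False
  obtain g where g: "riemannian_metric A g"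
    "\<And>\<phi> p u v. \<phi> \<in> A \<Longrightarrow> p \<in> fst \<phi> \<Longrightarrow> g \<phi> p (J \<phi> p u) (J \<phi> p v) = g \<phi> p u v"
    using ex_metric by blast
  have G: "bilinear (g \<theta> p)" "\<And>u v. g \<theta> p u v = g \<theta> p v u" "\<And>u. u \<noteq> 0 \<Longrightarrow> g \<theta> p u u > 0"
    if "\<theta> \<in> A" "p \<in> fst \<theta>" for \<theta> p
    using g(1) that unfolding riemannian_metric_def by blast+
  let ?T = "trans_diff \<phi> \<psi> p"
  have tr: "g \<psi> p (?T u) (?T v) = g \<phi> p u v" for u v
    using g(1) assms unfolding riemannian_metric_def by metis
  have p: "p \<in> fst \<phi>" "p \<in> fst \<psi>" using assms by auto
  have "g \<phi> p u (J \<phi> p u) = g \<phi> p (J \<phi> p u) (- u)"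
    using g(2)[OF assms(1) p(1), of u "J \<phi> p u"] J_J[OF assms(1) p(1)] by simp
  then have "g \<phi> p u (J \<phi> p u) = 0"
    using G(2)[OF assms(1) p(1), of u "J \<phi> p u"] bilinear_rneg[OF G(1)[OF assms(1) p(1)], of "J \<phi> p u" u]
    by simp
  then have "?T (J \<phi> p u) = rot90 (g \<psi> p (axis 1 1) (axis 1 1)) (g \<psi> p (axis 1 1) (axis 2 1))
      (g \<psi> p (axis 2 1) (axis 2 1)) (?T u)"
    using trans_diff_props(2)[OF A assms] J_det[OF assms(1) p(1) False] g(2)[OF assms(1) p(1)]
    by (intro rot90_unique G(1-3) assms p) (auto simp: tr)
  moreover have "J \<psi> p (?T u) = rot90 (g \<psi> p (axis 1 1) (axis 1 1)) (g \<psi> p (axis 1 1) (axis 2 1))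
      (g \<psi> p (axis 2 1) (axis 2 1)) (?T u)"
    by (intro complex_structure_rot90 G(1-3) g(2) J_linear J_J J_det assms p)
  ultimately show ?thesis by simp
qed

lemma one_form_J:
  fixes \<omega> :: "('m, 'w::real_normed_vector) form1"
  assumes "one_form A \<omega>"
  shows "one_form A (\<lambda>\<phi> p u. \<omega> \<phi> p (J \<phi> p u))"
proof (rule one_formI[OF A])
  show "linear (\<lambda>u. \<omega> \<phi> p (J \<phi> p u))" if "\<phi> \<in> A" "p \<in> fst \<phi>" for \<phi> p
    using linear_compose[OF J_linear one_form_linear[OF A assms], unfolded o_def] that by blast
  show "\<omega> \<psi> p (J \<psi> p (trans_diff \<phi> \<psi> p u)) = \<omega> \<phi> p (J \<phi> p u)"
    if "\<phi> \<in> A" "\<psi> \<in> A" "p \<in> fst \<phi> \<inter> fst \<psi>" for \<phi> \<psi> p u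
    unfolding J_trans[OF that] by (rule one_form_trans[OF A assms that])
  fix \<phi> u assume \<phi>: "\<phi> \<in> A"
  note o = open_coord[OF A \<phi>]
  \<comment> \<open>The argument \<open>J \<phi> p u\<close> varies with the point, while smoothness
    of a form is given for constant arguments; the expansion in the standard basis separates the
    two.\<close>
  have eq: "\<omega> \<phi> p v = (\<Sum>i\<in>UNIV. v $ i *\<^sub>R \<omega> \<phi> p (axis i 1))" if "p \<in> fst \<phi>" for p v
  proof -
    interpret linear "\<omega> \<phi> p" using one_form_linear[OF A assms \<phi> that] .
    have "v = (\<Sum>i\<in>UNIV. v $ i *\<^sub>R axis i 1)"
      by (simp add: vec_eq_iff axis_def forall_2 UNIV_2)
    then have "\<omega> \<phi> p v = \<omega> \<phi> p (\<Sum>i\<in>UNIV. v $ i *\<^sub>R axis i 1)" by simp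
    then show ?thesis by (simp add: sum scaleR)
  qed
  have "smooth_on (coord \<phi>) (\<lambda>x. \<Sum>i\<in>UNIV. (J \<phi> (chart_inv \<phi> x) u) $ i *\<^sub>R \<omega> \<phi> (chart_inv \<phi> x) (axis i 1))"
    by (intro smooth_on_sum[OF o] smooth_on_bilinear[OF o bounded_bilinear_scaleR]
        smooth_on_vec_nth[OF o] J_smooth[OF \<phi>] one_form_smooth[OF A assms \<phi>])
  then show "smooth_on (coord \<phi>) (\<lambda>x. \<omega> \<phi> (chart_inv \<phi> x) (J \<phi> (chart_inv \<phi> x) u))"
    by (rule smooth_on_cong[OF o, rotated]) (simp add: eq[OF chart_inv_in[OF A]])
qed

end


section \<open>Curvature and endomorphism-valued forms\<close>

lemma bounded_bilinear_matrix_mult: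
  "bounded_bilinear ((**) :: complex^'k::finite^'k \<Rightarrow> complex^'k^'k \<Rightarrow> complex^'k^'k)"
  unfolding bilinear_conv_bounded_bilinear[symmetric] bilinear_def
  by (auto intro!: linearI simp: matrix_matrix_mult_def vec_eq_iff scaleR_sum_right sum.distrib algebra_simps)

lemma bounded_bilinear_matrix_vector_mult:
  "bounded_bilinear ((*v) :: complex^'k::finite^'k \<Rightarrow> complex^'k \<Rightarrow> complex^'k)"
  unfolding bilinear_conv_bounded_bilinear[symmetric] bilinear_def
  by (auto intro!: linearI simp: matrix_vector_right_distrib matrix_vector_mult_add_rdistrib)
    (auto simp: matrix_vector_mult_def vec_eq_iff scaleR_sum_right)

lemma cscale_nth [simp]: "cscale c B $ i $ j = c * B $ i $ j"
  by (simp add: cscale_def)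

lemma bounded_linear_cscale: "bounded_linear (cscale c :: complex^'k::finite^'k \<Rightarrow> _)"
  unfolding linear_conv_bounded_linear[symmetric]
  by (auto intro!: linearI simp: vec_eq_iff algebra_simps)

lemmas matrix_distribs =
  bounded_bilinear.add_left[OF bounded_bilinear_matrix_mult]
  bounded_bilinear.add_right[OF bounded_bilinear_matrix_mult]
  bounded_bilinear.diff_left[OF bounded_bilinear_matrix_mult]
  bounded_bilinear.diff_right[OF bounded_bilinear_matrix_mult]
  bounded_bilinear.minus_left[OF bounded_bilinear_matrix_mult]
  bounded_bilinear.minus_right[OF bounded_bilinear_matrix_mult]
  matrix_mul_assoc

lemma cscale_matrix_mult:
  fixes B B' :: "complex^'k::finite^'k"
  shows "cscale c B ** B' = cscale c (B ** B')" "B ** cscale c B' = cscale c (B ** B')"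
  by (auto simp: matrix_matrix_mult_def vec_eq_iff sum_distrib_left algebra_simps)

lemma lie_add: "lie (a + b) c = lie a c + lie b c" "lie a (b + c) = lie a b + lie a c"
  by (simp_all add: lie_def matrix_distribs)

lemma lie_cscale: "lie (cscale c a) b = cscale c (lie a b)" "lie a (cscale c b) = cscale c (lie a b)"
  by (simp_all add: lie_def cscale_matrix_mult) (simp_all add: vec_eq_iff algebra_simps)

lemma lie_swap: "lie a b = - lie b a"
  by (simp add: lie_def)

lemma bracket_wedge_add:
  "bracket_wedge (\<lambda>\<phi> p u. \<mu> \<phi> p u + \<nu> \<phi> p u) \<eta> \<phi> p u v = bracket_wedge \<mu> \<eta> \<phi> p u v + bracket_wedge \<nu> \<eta> \<phi> p u v"
  "bracket_wedge \<eta> (\<lambda>\<phi> p u. \<mu> \<phi> p u + \<nu> \<phi> p u) \<phi> p u v = bracket_wedge \<eta> \<mu> \<phi> p u v + bracket_wedge \<eta> \<nu> \<phi> p u v"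
  by (simp_all add: bracket_wedge_def lie_add)

lemma bracket_wedge_cscale:
  "bracket_wedge (\<lambda>\<phi> p u. cscale c (\<mu> \<phi> p u)) \<eta> \<phi> p u v = cscale c (bracket_wedge \<mu> \<eta> \<phi> p u v)"
  "bracket_wedge \<eta> (\<lambda>\<phi> p u. cscale c (\<mu> \<phi> p u)) \<phi> p u v = cscale c (bracket_wedge \<eta> \<mu> \<phi> p u v)"
  by (simp_all add: bracket_wedge_def lie_cscale) (simp_all add: vec_eq_iff algebra_simps)

lemma bracket_wedge_commute: "bracket_wedge \<mu> \<eta> \<phi> p u v = bracket_wedge \<eta> \<mu> \<phi> p u v"
  by (simp add: bracket_wedge_def lie_def)

lemma lie_eq_bracket_wedge: "lie (\<mu> \<phi> p u) (\<mu> \<phi> p v) = cscale (1/2) (bracket_wedge \<mu> \<mu> \<phi> p u v)"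
  by (simp add: bracket_wedge_def lie_swap[of "\<mu> \<phi> p v"] vec_eq_iff)

lemma part10_add_part01: "(\<lambda>\<phi> p u. part10 J \<mu> \<phi> p u + part01 J \<mu> \<phi> p u) = \<mu>"
  by (intro ext) (simp add: part10_def part01_def vec_eq_iff algebra_simps)

text \<open>Precomposition with \<open>J\<close> multiplies the (1,0)-part by i and the (0,1)-part
  by -i, and the star carries a further minus sign.\<close>

lemma star_conv_parts:
  "star J \<mu> = (\<lambda>\<phi> p u. cscale (- \<i>) (part10 J \<mu> \<phi> p u) + cscale \<i> (part01 J \<mu> \<phi> p u))"
  by (intro ext) (simp add: star_def part10_def part01_def vec_eq_iff algebra_simps)

lemma chart_differentiable_bilinear:
  assumes "bounded_bilinear h" "chart_differentiable \<phi> p f" "chart_differentiable \<phi> p g"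
  shows "chart_differentiable \<phi> p (\<lambda>x. h (f x) (g x))"
  using bounded_bilinear.FDERIV[OF assms(1) has_derivative_d0[OF assms(2)] has_derivative_d0[OF assms(3)]]
  unfolding differentiable_def o_def by blast

text \<open>The curvature of the connection d + B. The quadratic term is half of [B \<and> B], and
  working with the form instead of the operator lets the splitting and the spectral family share one
  formula.\<close>

definition curvature :: "('m, 'k::finite) endform \<Rightarrow> ('m, complex^'k^'k) form2" where
  "curvature B \<phi> p u v = d1 B \<phi> p u v + lie (B \<phi> p u) (B \<phi> p v)"

section \<open>Curvature and covariant derivatives in the presence of a parallel projection\<close>

context
  fixes A :: "('m::{t2_space,second_countable_topology}) chart set"
  assumes A: "oriented_surface A"
begin

lemma d1_add:
  assumes "one_form A \<mu>" "one_form A \<eta>" "\<phi> \<in> A" "p \<in> fst \<phi>"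
  shows "d1 (\<lambda>\<phi> p u. \<mu> \<phi> p u + \<eta> \<phi> p u) \<phi> p u v = d1 \<mu> \<phi> p u v + d1 \<eta> \<phi> p u v"
  using one_form_differentiable[OF A assms(1,3,4)] one_form_differentiable[OF A assms(2,3,4)]
  by (simp add: d1_def d0_add)

lemma d1_bounded_linear:
  assumes "bounded_linear h" "one_form A \<mu>" "\<phi> \<in> A" "p \<in> fst \<phi>"
  shows "d1 (\<lambda>\<phi> p u. h (\<mu> \<phi> p u)) \<phi> p u v = h (d1 \<mu> \<phi> p u v)"
  using one_form_differentiable[OF A assms(2-4)]
  by (simp add: d1_def d0_bounded_linear[OF assms(1)] linear_diff[OF bounded_linear.linear[OF assms(1)]])

lemma dcov_End_add:
  assumes "one_form A \<mu>" "one_form A \<eta>" "\<phi> \<in> A" "p \<in> fst \<phi>"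
  shows "dcov_End D (\<lambda>\<phi> p u. \<mu> \<phi> p u + \<eta> \<phi> p u) \<phi> p u v = dcov_End D \<mu> \<phi> p u v + dcov_End D \<eta> \<phi> p u v"
  by (simp add: dcov_End_def d1_add[OF assms] bracket_wedge_add)

lemma dcov_End_cscale:
  assumes "one_form A \<mu>" "\<phi> \<in> A" "p \<in> fst \<phi>"
  shows "dcov_End D (\<lambda>\<phi> p u. cscale c (\<mu> \<phi> p u)) \<phi> p u v = cscale c (dcov_End D \<mu> \<phi> p u v)"
  by (simp add: dcov_End_def d1_bounded_linear[OF bounded_linear_cscale assms] bracket_wedge_cscale)
    (simp add: vec_eq_iff algebra_simps)

text \<open>The cross terms of the quadratic part are exactly the bracket in d^D. The formula serves
  twice: to split the given flat connection, and to expand every member of the spectral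
  family.\<close>

lemma curvature_add:
  assumes "one_form A (end_form D)" "one_form A \<eta>" "\<phi> \<in> A" "p \<in> fst \<phi>"
  shows "curvature (\<lambda>\<phi> p u. end_form D \<phi> p u + \<eta> \<phi> p u) \<phi> p u v =
    curvature (end_form D) \<phi> p u v + dcov_End D \<eta> \<phi> p u v + cscale (1/2) (bracket_wedge \<eta> \<eta> \<phi> p u v)"
  unfolding lie_eq_bracket_wedge[symmetric]
  by (simp add: curvature_def dcov_End_def d1_add[OF assms] bracket_wedge_def lie_add
      lie_swap[of "end_form D \<phi> p v"])

text \<open>The bundle with projection \<open>P\<close> is parallel for \<open>d + B\<close>, so the curvature preserves the
  splitting; this is the derivative of the parallelism equation.\<close>

lemma curvature_commutes_with_projection:
  fixes P :: "'m \<Rightarrow> complex^'k::finite^'k"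
  assumes B: "one_form A B" and P: "smooth_map A P" and \<phi>: "\<phi> \<in> A" "p \<in> fst \<phi>"
    and parallel: "\<And>p u. p \<in> fst \<phi> \<Longrightarrow> d0 P \<phi> p u = P p ** B \<phi> p u - B \<phi> p u ** P p"
    and "d1 (d0 P) \<phi> p u v = 0"
  shows "P p ** curvature B \<phi> p u v = curvature B \<phi> p u v ** P p"
proof -
  note dB = one_form_differentiable[OF A B \<phi>] and dP = smooth_map_differentiable[OF A P \<phi>]
  note bb = bounded_bilinear_matrix_mult
  have diff: "chart_differentiable \<phi> p (\<lambda>x. P x ** B \<phi> x w)"
    "chart_differentiable \<phi> p (\<lambda>x. B \<phi> x w ** P x)" for w
    by (intro chart_differentiable_bilinear[OF bb] dP dB)+
  have dd: "d0 (\<lambda>x. d0 P \<phi> x w) \<phi> p z =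
      P p ** d0 (\<lambda>x. B \<phi> x w) \<phi> p z + d0 P \<phi> p z ** B \<phi> p w
      - (B \<phi> p w ** d0 P \<phi> p z + d0 (\<lambda>x. B \<phi> x w) \<phi> p z ** P p)" for w z
  proof -
    have "d0 (\<lambda>x. d0 P \<phi> x w) \<phi> p z = d0 (\<lambda>x. P x ** B \<phi> x w - B \<phi> x w ** P x) \<phi> p z"
      by (subst d0_cong[OF A \<phi> parallel]) auto
    then show ?thesis
      by (simp add: d0_diff[OF diff] d0_bilinear[OF A bb \<phi>] dP dB)
  qed
  show ?thesis
    using assms(6) unfolding d1_def dd parallel[OF \<phi>(2)] curvature_def lie_def
    by (simp add: matrix_distribs d1_def algebra_simps)
qed

text \<open>For an idempotent \<open>P\<close>, the equation PN + NP = N says that N maps image and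
  kernel of P into each other. The covariant derivative of this equation is the claim, because P is
  parallel and passes through d^D.\<close>

lemma dcov_End_exchanges_projection:
  fixes P :: "'m \<Rightarrow> complex^'k::finite^'k"
  assumes B: "one_form A (end_form D)" and N: "one_form A N" and P: "smooth_map A P"
    and \<phi>: "\<phi> \<in> A" "p \<in> fst \<phi>"
    and parallel: "\<And>p u. p \<in> fst \<phi> \<Longrightarrow> d0 P \<phi> p u = P p ** end_form D \<phi> p u - end_form D \<phi> p u ** P p"
    and off: "\<And>p u. p \<in> fst \<phi> \<Longrightarrow> P p ** N \<phi> p u + N \<phi> p u ** P p = N \<phi> p u"
  shows "P p ** dcov_End D N \<phi> p u v + dcov_End D N \<phi> p u v ** P p = dcov_End D N \<phi> p u v"
proof -
  note dN = one_form_differentiable[OF A N \<phi>] and dP = smooth_map_differentiable[OF A P \<phi>]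
  note bb = bounded_bilinear_matrix_mult
  have diff: "chart_differentiable \<phi> p (\<lambda>x. P x ** N \<phi> x w)"
    "chart_differentiable \<phi> p (\<lambda>x. N \<phi> x w ** P x)" for w
    by (intro chart_differentiable_bilinear[OF bb] dP dN)+
  have dd: "d0 (\<lambda>x. N \<phi> x w) \<phi> p z =
      P p ** d0 (\<lambda>x. N \<phi> x w) \<phi> p z + d0 P \<phi> p z ** N \<phi> p w
      + (N \<phi> p w ** d0 P \<phi> p z + d0 (\<lambda>x. N \<phi> x w) \<phi> p z ** P p)" for w z
  proof -
    have "d0 (\<lambda>x. N \<phi> x w) \<phi> p z = d0 (\<lambda>x. P x ** N \<phi> x w + N \<phi> x w ** P x) \<phi> p z"
      by (subst d0_cong[OF A \<phi> off[symmetric]]) auto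
    then show ?thesis
      by (simp add: d0_add[OF diff] d0_bilinear[OF A bb \<phi>] dP dN)
  qed
  have PN: "P p ** N \<phi> p w = N \<phi> p w - N \<phi> p w ** P p" for w
    using off[OF \<phi>(2), of w] by (simp add: algebra_simps)
  define b where "b = end_form D \<phi> p"
  define n where "n = N \<phi> p"
  define n' where "n' = (\<lambda>z w. d0 (\<lambda>x. N \<phi> x w) \<phi> p z)"
  define \<pi> where "\<pi> = P p"
  \<comment> \<open>Rules pushing \<pi> to the right past n. The variant with a prefix x is required
    since products are normalised by bracketing to the left.\<close>
  have PN': "\<pi> ** n w = n w - n w ** \<pi>" for w
    using PN by (simp add: n_def \<pi>_def)
  then have PN'': "x ** \<pi> ** n w = x ** n w - x ** n w ** \<pi>" for w and x :: "complex^'k^'k"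
    by (simp flip: matrix_mul_assoc add: bounded_bilinear.diff_right[OF bb])
  have dd': "n' z w = \<pi> ** n' z w + (\<pi> ** b z - b z ** \<pi>) ** n w
      + (n w ** (\<pi> ** b z - b z ** \<pi>) + n' z w ** \<pi>)" for z w
    using dd[of w z] unfolding parallel[OF \<phi>(2)] b_def n_def n'_def \<pi>_def .
  \<comment> \<open>The product rule \<open>dd'\<close>, solved for the part in which \<pi> meets
    n'. As its left side recurs on its right, it is inserted at a single occurrence.\<close>
  have k: "\<pi> ** n' z w + n' z w ** \<pi> = n' z w - (\<pi> ** b z - b z ** \<pi>) ** n w
      - n w ** (\<pi> ** b z - b z ** \<pi>)" for z w
    by (subst (3) dd') simp
  have L: "dcov_End D N \<phi> p u v = n' u v - n' v u + (lie (b u) (n v) - lie (b v) (n u))"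
    by (simp add: dcov_End_def d1_def bracket_wedge_def b_def n_def n'_def)
  have "\<pi> ** dcov_End D N \<phi> p u v + dcov_End D N \<phi> p u v ** \<pi> =
      (\<pi> ** n' u v + n' u v ** \<pi>) - (\<pi> ** n' v u + n' v u ** \<pi>)
      + (\<pi> ** (lie (b u) (n v) - lie (b v) (n u)) + (lie (b u) (n v) - lie (b v) (n u)) ** \<pi>)"
    unfolding L by (simp add: matrix_distribs)
  also have "\<dots> = dcov_End D N \<phi> p u v"
    unfolding k L lie_def
    by (simp add: matrix_distribs PN' PN'' algebra_simps)
  finally show ?thesis by (simp add: \<pi>_def)
qed

end

text \<open>Block-diagonal and off-diagonal matrices meet only in 0. Concretely, Y = -X turns the
  exchange equation into X = 2PX; multiplication by P gives PX = 2PX, so PX = 0 and X = 0.\<close>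

lemma commuting_exchanging_disjoint:
  fixes P X Y :: "complex^'k::finite^'k"
  assumes "P ** P = P" "P ** X = X ** P" "P ** Y + Y ** P = Y" "X + Y = 0"
  shows "X = 0" "Y = 0"
proof -
  have Y: "Y = - X" using assms(4) by (simp add: eq_neg_iff_add_eq_0 add.commute)
  have X: "X = P ** X + P ** X"
    using assms(3) unfolding Y by (simp add: matrix_distribs assms(2) eq_neg_iff_add_eq_0)
  then have "P ** X = P ** (P ** X + P ** X)" by simp
  then have "P ** X = P ** X + P ** X"
    by (simp only: matrix_add_ldistrib matrix_mul_assoc assms(1))
  then have "P ** X = 0" by simp
  with X show "X = 0" by simp
  then show "Y = 0" using Y by simp
qed

section \<open>Forms of type (1,0) and (0,1)\<close>

context
  fixes A :: "('m::{t2_space,second_countable_topology}) chart set" and C J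
  assumes A: "oriented_surface A" and C: "conformal_structure A C"
    and J: "induced_complex_structure A C J"
begin

lemma one_form_part10: "one_form A \<mu> \<Longrightarrow> one_form A (part10 J \<mu>)"
  unfolding part10_def[abs_def]
  by (intro one_form_bounded_linear[OF A bounded_linear_cscale] one_form_diff[OF A] one_form_J[OF A C J])

lemma one_form_part01: "one_form A \<mu> \<Longrightarrow> one_form A (part01 J \<mu>)"
  unfolding part01_def[abs_def]
  by (intro one_form_bounded_linear[OF A bounded_linear_cscale] one_form_add[OF A] one_form_J[OF A C J])

lemma part10_J:
  assumes "one_form A \<mu>" "\<phi> \<in> A" "p \<in> fst \<phi>"
  shows "part10 J \<mu> \<phi> p (J \<phi> p u) = cscale \<i> (part10 J \<mu> \<phi> p u)"
proof -
  have "\<mu> \<phi> p (J \<phi> p (J \<phi> p u)) = - \<mu> \<phi> p u"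
    using linear_neg[OF one_form_linear[OF A assms]] by (simp add: J_J[OF A C J assms(2,3)])
  then show ?thesis
    by (simp add: part10_def) (simp add: vec_eq_iff algebra_simps)
qed

lemma part01_J:
  assumes "one_form A \<mu>" "\<phi> \<in> A" "p \<in> fst \<phi>"
  shows "part01 J \<mu> \<phi> p (J \<phi> p u) = cscale (- \<i>) (part01 J \<mu> \<phi> p u)"
proof -
  have "\<mu> \<phi> p (J \<phi> p (J \<phi> p u)) = - \<mu> \<phi> p u"
    using linear_neg[OF one_form_linear[OF A assms]] by (simp add: J_J[OF A C J assms(2,3)])
  then show ?thesis
    by (simp add: part01_def) (simp add: vec_eq_iff algebra_simps)
qed

text \<open>A surface carries no nonzero forms of type \<open>(2,0)\<close> or \<open>(0,2)\<close>.\<close>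

lemma bracket_wedge_same_type:
  assumes \<mu>: "one_form A \<mu>" and \<eta>: "one_form A \<eta>" and \<phi>: "\<phi> \<in> A" "p \<in> fst \<phi>"
    and "\<And>u. \<mu> \<phi> p (J \<phi> p u) = cscale c (\<mu> \<phi> p u)" "\<And>u. \<eta> \<phi> p (J \<phi> p u) = cscale c (\<eta> \<phi> p u)"
  shows "bracket_wedge \<mu> \<eta> \<phi> p u v = 0"
proof (cases "u = 0")
  case True
  then show ?thesis
    using linear_0[OF one_form_linear[OF A \<mu> \<phi>]] linear_0[OF one_form_linear[OF A \<eta> \<phi>]]
    by (simp add: bracket_wedge_def lie_def)
next
  case False
  define w where "w = J \<phi> p u"
  define d where "d = u $ 1 * w $ 2 - u $ 2 * w $ 1"
  have "d > 0" using J_det[OF A C J \<phi> False] by (simp add: d_def w_def det_2)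
  \<comment> \<open>Cramer's rule for the coordinates of v in the basis u, J u, whose determinant is
    d.\<close>
  define a b where "a = (v $ 1 * w $ 2 - v $ 2 * w $ 1) / d" and "b = (u $ 1 * v $ 2 - u $ 2 * v $ 1) / d"
  have v: "v = a *\<^sub>R u + b *\<^sub>R w"
  proof -
    have "d * a = v $ 1 * w $ 2 - v $ 2 * w $ 1" "d * b = u $ 1 * v $ 2 - u $ 2 * v $ 1"
      using \<open>d > 0\<close> by (simp_all add: a_def b_def)
    then have "d * v $ 1 = d * (a * u $ 1 + b * w $ 1)" "d * v $ 2 = d * (a * u $ 2 + b * w $ 2)"
      unfolding d_def by algebra+
    then show ?thesis using \<open>d > 0\<close> by (simp add: vec_eq_iff forall_2)
  qed
  \<comment> \<open>The factor depends on v and on the type c, but not on the form. Hence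
    [\<mu>_u, \<eta>_v] and [\<mu>_v, \<eta>_u] are the same multiple of [\<mu>_u, \<eta>_u] and
    cancel.\<close>
  have mult: "\<nu> \<phi> p v = cscale (of_real a + of_real b * c) (\<nu> \<phi> p u)"
    if "one_form A \<nu>" "\<And>u. \<nu> \<phi> p (J \<phi> p u) = cscale c (\<nu> \<phi> p u)" for \<nu> :: "('m, 'a) endform"
  proof -
    interpret linear "\<nu> \<phi> p" using one_form_linear[OF A that(1) \<phi>] .
    show ?thesis
      unfolding v by (simp add: add scaleR w_def that(2)) (simp only: vec_eq_iff vector_scaleR_component vector_add_component cscale_nth, simp add: scaleR_conv_of_real algebra_simps)
  qed
  show ?thesis
    unfolding bracket_wedge_def mult[where \<nu> = \<mu>, OF \<mu> assms(5)] mult[where \<nu> = \<eta>, OF \<eta> assms(6)]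
    by (simp add: lie_cscale)
qed

end


section \<open>Smoothness of the orthogonal projection\<close>

lemma mform_commute: "mform t v w = mform t w v"
  by (simp add: mform_def ac_simps)

lemma mform_right:
  "mform t v (w + w') = mform t v w + mform t v w'"
  "mform t v (w - w') = mform t v w - mform t v w'"
  "mform t v (c *s w) = c * mform t v w"
  by (simp_all add: mform_def algebra_simps sum.distrib sum_subtractf sum_distrib_left)

lemma mform_zero [simp]: "mform t v 0 = 0" "mform t 0 v = 0"
  by (simp_all add: mform_def)

lemma mform_sum_right: "mform t v (\<Sum>b\<in>I. f b) = (\<Sum>b\<in>I. mform t v (f b))"
  by (induction I rule: infinite_finite_induct) (simp_all add: mform_right)

lemma mform_eq_0_imp:
  assumes "\<And>w. mform t v w = 0"
  shows "v = 0"
proof -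
  have "v $ i = 0" for i
    using assms[of "axis i 1"]
    by (auto simp: mform_def axis_def if_distrib cong: if_cong split: if_splits)
  then show ?thesis by (simp add: vec_eq_iff)
qed

lemma bounded_bilinear_mform: "bounded_bilinear (mform t :: complex^'k::finite \<Rightarrow> _)"
  unfolding bilinear_conv_bounded_bilinear[symmetric] bilinear_def
  by (auto intro!: linearI simp: mform_def sum.distrib scaleR_sum_right algebra_simps)

lemma bounded_bilinear_vector_smult:
  "bounded_bilinear ((*s) :: complex \<Rightarrow> complex^'k::finite \<Rightarrow> _)"
  unfolding bilinear_conv_bounded_bilinear[symmetric] bilinear_def
  by (auto intro!: linearI simp: vec_eq_iff algebra_simps)

lemma subspace_perp: "vec.subspace (perp t W)"
  by (rule vec.subspaceI)
    (auto simp: perp_def mform_right)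

text \<open>Two candidates differ by an element of \<open>W\<close> orthogonal to \<open>W\<close>,
  which nondegeneracy excludes; so exhibiting one candidate evaluates the definite
  description.\<close>

lemma proj_eqI:
  assumes "vec.subspace W" "\<And>v. v \<in> W \<Longrightarrow> (\<And>w. w \<in> W \<Longrightarrow> mform t v w = 0) \<Longrightarrow> v = 0"
    and "z \<in> W" "w - z \<in> perp t W"
  shows "proj t W w = z"
  unfolding proj_def
proof (rule the_equality)
  fix z' assume z': "z' \<in> W \<and> w - z' \<in> perp t W"
  have "(w - z') - (w - z) \<in> perp t W"
    using z' by (intro vec.subspace_diff[OF subspace_perp _ assms(4)]) blast
  then have "mform t (z - z') v = 0" if "v \<in> W" for v
    using that by (simp add: perp_def mform_commute[of t "z - z'"])
  then have "z - z' = 0"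
    using z' assms(1,3) by (intro assms(2)) (auto intro: vec.subspace_diff)
  then show "z' = z" by simp
qed (use assms in auto)

lemma matrix_proj_props:
  fixes W :: "(complex^'k::finite) set"
  assumes W: "vec.subspace W" and nd: "\<And>v. v \<in> W \<Longrightarrow> (\<And>w. w \<in> W \<Longrightarrow> mform t v w = 0) \<Longrightarrow> v = 0"
    and ex: "\<And>w. \<exists>z\<in>W. w - z \<in> perp t W"
  shows "proj t W w = matrix (proj t W) *v w"
    and "proj t (perp t W) w = w - matrix (proj t W) *v w"
    and "matrix (proj t W) ** matrix (proj t W) = matrix (proj t W)"
proof -
  have p: "proj t W w \<in> W" "w - proj t W w \<in> perp t W" for w
  proof -
    obtain z where z: "z \<in> W" "w - z \<in> perp t W" using ex by blast
    have "proj t W w = z" by (rule proj_eqI[OF W nd z])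
    with z show "proj t W w \<in> W" "w - proj t W w \<in> perp t W" by simp_all
  qed
  have lin: "Vector_Spaces.linear (*s) (*s) (proj t W)"
  proof (unfold_locales)
    show "proj t W (v + w) = proj t W v + proj t W w" for v w
      using vec.subspace_add[OF subspace_perp p(2)[of v] p(2)[of w]]
      by (intro proj_eqI[OF W nd] vec.subspace_add[OF W] p(1)) (auto simp: algebra_simps)
    show "proj t W (c *s w) = c *s proj t W w" for c w
      using vec.subspace_scale[OF subspace_perp p(2)[of w], of c]
      by (intro proj_eqI[OF W nd] vec.subspace_scale[OF W] p(1)) (auto simp: vec.scale_right_diff_distrib)
  qed
  show *: "proj t W w = matrix (proj t W) *v w" for w
    by (simp add: matrix_works[OF lin])
  show "proj t (perp t W) w = w - matrix (proj t W) *v w"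
    unfolding *[symmetric]
  proof (rule proj_eqI[OF subspace_perp _ p(2)])
    fix v assume v: "v \<in> perp t W" "\<And>w. w \<in> perp t W \<Longrightarrow> mform t v w = 0"
    \<comment> \<open>The complement is nondegenerate too: v is orthogonal to both summands of every
      w, hence to the whole space.\<close>
    have "mform t v w = 0" for w
    proof -
      have "mform t v (proj t W w) = 0"
        using v(1) p(1)[of w] by (simp add: perp_def mform_commute[of t v])
      with v(2)[OF p(2)[of w]] show ?thesis by (simp add: mform_right)
    qed
    then show "v = 0" by (rule mform_eq_0_imp)
  next
    show "w - (w - proj t W w) \<in> perp t (perp t W)"
      using p(1)[of w] by (simp add: perp_def mform_commute)
  qed
  have "proj t W (proj t W w) = proj t W w" for w
    using p(1) by (intro proj_eqI[OF W nd]) (auto simp: perp_def)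
  then show "matrix (proj t W) ** matrix (proj t W) = matrix (proj t W)"
    by (simp add: matrix_eq * flip: matrix_vector_mul_assoc)
qed

text \<open>A local frame of the subbundle, indexed by a subset \<open>T\<close> of the coordinates of the ambient
  space and extended by zero, so that its Gram matrix can be treated as a matrix of fixed size.\<close>

lemma ex_padded_frame:
  fixes V :: "'m::{t2_space,second_countable_topology} \<Rightarrow> (complex^'k::finite) set"
  assumes "subbundle A V"
  shows "\<exists>U T (f :: 'k \<Rightarrow> 'm \<Rightarrow> complex^'k). open U \<and> p \<in> U \<and> (\<forall>b. smooth_map_on A U (f b)) \<and>
    (\<forall>x\<in>U. (\<forall>b. b \<notin> T \<longrightarrow> f b x = 0) \<and> vec.span (range (\<lambda>b. f b x)) = V x \<and>
      (\<forall>c b. (\<Sum>b\<in>UNIV. c $ b *s f b x) = 0 \<longrightarrow> b \<in> T \<longrightarrow> c $ b = 0))"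
proof -
  obtain U and r :: nat and s where U: "open U" "p \<in> U" "\<And>i. i < r \<Longrightarrow> smooth_map_on A U (s i)"
    and s: "\<And>x. x \<in> U \<Longrightarrow> inj_on (\<lambda>i. s i x) {..<r} \<and> vec.independent ((\<lambda>i. s i x) ` {..<r}) \<and>
        vec.span ((\<lambda>i. s i x) ` {..<r}) = V x"
    using assms unfolding subbundle_def by metis
  have "r = card ((\<lambda>i. s i p) ` {..<r})"
    using s[OF U(2)] by (simp add: card_image)
  also have "\<dots> \<le> vec.dim (UNIV :: (complex^'k) set)"
    using s[OF U(2)] by (intro vec.independent_card_le_dim) auto
  finally have "r \<le> CARD('k)" by (simp only: vec_dim_card)
  \<comment> \<open>The rank is at most the number of coordinates, so frame indices can be embedded
    among them.\<close>
  then obtain e :: "nat \<Rightarrow> 'k" where e: "inj_on e {..<r}"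
    using card_le_inj[of "{..<r}" "UNIV :: 'k set"] by auto
  define T where "T = e ` {..<r}"
  define f where "f b x = (if b \<in> T then s (inv_into {..<r} e b) x else 0)" for b x
  have fe: "f (e i) x = s i x" if "i < r" for i x
    using that e by (auto simp: f_def T_def)
  have sm: "smooth_map_on A U (f b)" for b
  proof (cases "b \<in> T")
    case True
    then obtain i where "i < r" "b = e i" by (auto simp: T_def)
    then have "f b = s i" using fe by auto
    then show ?thesis using U(3) \<open>i < r\<close> by simp
  next
    case False
    then have "f b = (\<lambda>x. 0)" by (auto simp: f_def)
    then show ?thesis by (simp add: smooth_map_on_def o_def smooth_on_const)
  qed
  have sp: "vec.span (range (\<lambda>b. f b x)) = V x" if x: "x \<in> U" for x
  proof -
    have "(\<lambda>i. s i x) ` {..<r} \<subseteq> range (\<lambda>b. f b x)" using fe[symmetric] by auto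
    moreover have "range (\<lambda>b. f b x) \<subseteq> insert 0 ((\<lambda>i. s i x) ` {..<r})"
      using fe by (auto simp: f_def T_def)
    ultimately have "vec.span (range (\<lambda>b. f b x)) = vec.span ((\<lambda>i. s i x) ` {..<r})"
      using vec.span_mono vec.span_insert_0 by (metis subset_antisym)
    then show ?thesis using s[OF x] by simp
  qed
  have ind: "c $ b = 0" if x: "x \<in> U" and c: "(\<Sum>b\<in>UNIV. c $ b *s f b x) = 0" and b: "b \<in> T" for x c b
  proof -
    let ?S = "(\<lambda>i. s i x) ` {..<r}" and ?inv = "inv_into {..<r} (\<lambda>i. s i x)"
    have inj: "inj_on (\<lambda>i. s i x) {..<r}" using s[OF x] by simp
    \<comment> \<open>Independence is a property of the set of frame vectors, so the combination is
      reindexed from coordinates to vectors.\<close>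
    have "(\<Sum>v\<in>?S. c $ e (?inv v) *s v) = (\<Sum>i<r. c $ e i *s s i x)"
      using inj by (subst sum.reindex) (auto intro!: sum.cong simp: inv_into_f_f[OF inj])
    also have "\<dots> = (\<Sum>b\<in>T. c $ b *s f b x)"
      unfolding T_def using e by (subst sum.reindex) (auto simp: fe intro!: sum.cong)
    also have "\<dots> = 0"
      unfolding c[symmetric] by (rule sum.mono_neutral_left) (auto simp: f_def)
    finally have 0: "(\<Sum>v\<in>?S. c $ e (?inv v) *s v) = 0" .
    obtain i where i: "i < r" "b = e i" using b by (auto simp: T_def)
    have "c $ e (?inv (s i x)) = 0"
      using vec.independentD[OF _ _ subset_refl 0, of "s i x"] s[OF x] i(1) by auto
    then show ?thesis using i inv_into_f_f[OF inj, of i] by simp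
  qed
  show ?thesis
    by (intro exI[of _ U] exI[of _ T] exI[of _ f] conjI allI ballI impI U sm sp) (simp_all add: f_def ind)
qed

text \<open>The coefficients of the projection solve the Gram system G c = y, with y the products of
  w with the frame. Outside \<open>T\<close> the frame vanishes, and the added 1 on the diagonal
  keeps G invertible by forcing those coefficients to be 0. On \<open>T\<close>, a kernel vector
  gives an element of W orthogonal to W, hence a trivial relation. Cramer's rule is used because
  determinants are visibly smooth in the frame.\<close>

lemma proj_padded_frame:
  fixes f :: "'k::finite \<Rightarrow> complex^'k"
  assumes T: "\<And>b. b \<notin> T \<Longrightarrow> f b = 0" and span: "vec.span (range f) = W"
    and ind: "\<And>c b. (\<Sum>b\<in>UNIV. c $ b *s f b) = 0 \<Longrightarrow> b \<in> T \<Longrightarrow> c $ b = 0"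
    and nd: "\<And>v. v \<in> W \<Longrightarrow> (\<And>w. w \<in> W \<Longrightarrow> mform t v w = 0) \<Longrightarrow> v = 0"
  defines "G \<equiv> (\<chi> a b. mform t (f a) (f b) + (if a = b \<and> a \<notin> T then 1 else 0)) :: complex^'k^'k"
  defines "z \<equiv> \<lambda>w. \<Sum>b\<in>UNIV. (det (\<chi> i j. if j = b then mform t (f i) w else G $ i $ j) * inverse (det G)) *s f b"
  shows "det G \<noteq> 0" "z w \<in> W" "w - z w \<in> perp t W" "proj t W w = z w"
proof -
  have Gc: "(G *v c) $ a = mform t (f a) (\<Sum>b\<in>UNIV. c $ b *s f b) + (if a \<notin> T then c $ a else 0)" for c a
  proof -
    have "(G *v c) $ a = (\<Sum>b\<in>UNIV. mform t (f a) (f b) * c $ b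
        + (if b = a then (if a \<notin> T then c $ a else 0) else 0))"
      unfolding G_def matrix_vector_mult_def by (auto intro!: sum.cong simp: algebra_simps)
    then show ?thesis
      by (simp add: sum.distrib mform_sum_right mform_right mult.commute)
  qed
  have W: "vec.subspace W" using span by auto
  have inW: "(\<Sum>b\<in>UNIV. c $ b *s f b) \<in> W" for c
    unfolding span[symmetric] by (intro vec.span_sum vec.span_scale vec.span_base) auto
  have perpI: "v \<in> perp t W" if "\<And>a. mform t (f a) v = 0" for v
  proof -
    have "vec.span (range f) \<subseteq> {w. mform t v w = 0}"
      by (rule vec.span_minimal) (auto simp: trans[OF mform_commute that] mform_right intro!: vec.subspaceI)
    then show ?thesis
      using span by (auto simp: perp_def mform_commute[of t v])
  qed
  have "c = 0" if "G *v c = 0" for c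
  proof -
    have 0: "mform t (f a) (\<Sum>b\<in>UNIV. c $ b *s f b) + (if a \<notin> T then c $ a else 0) = 0" for a
      using that unfolding Gc[symmetric] by simp
    then have "mform t (f a) (\<Sum>b\<in>UNIV. c $ b *s f b) = 0" for a
      by (cases "a \<in> T") (use 0[of a] in \<open>auto simp: T\<close>)
    from perpI[OF this] have s0: "(\<Sum>b\<in>UNIV. c $ b *s f b) = 0"
      using nd[OF inW] by (auto simp: perp_def mform_commute)
    have "c $ a = 0" for a
      using 0[of a] ind[OF s0, of a] unfolding s0 by (cases "a \<in> T") simp_all
    then show ?thesis by (simp add: vec_eq_iff)
  qed
  then have "invertible G"
    by (metis invertible_left_inverse matrix_left_invertible_ker)
  then show detG: "det G \<noteq> 0" by (simp add: invertible_det_nz)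
  define y c where "y = (\<chi> a. mform t (f a) w)"
    and "c = (\<chi> k. det (\<chi> i j. if j = k then y $ i else G $ i $ j) / det G)"
  have z: "z w = (\<Sum>b\<in>UNIV. c $ b *s f b)"
    by (simp add: z_def c_def y_def divide_inverse cong: if_cong)
  have "G *v c = y"
    using cramer[OF detG] unfolding c_def by blast
  then have "mform t (f a) (w - z w) = 0" for a
    using Gc[of c a] by (cases "a \<in> T") (auto simp: mform_right z y_def T)
  then show perp: "w - z w \<in> perp t W" by (rule perpI)
  show "z w \<in> W" unfolding z by (rule inW)
  with perp show "proj t W w = z w" by (intro proj_eqI[OF W nd])
qed

text \<open>\<open>P\<close> is defined fibrewise without choosing a frame, so nothing has to be
  glued; frames serve only near a point, for existence of the decomposition and for
  smoothness.\<close>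

lemma ex_smooth_projection:
  fixes V :: "'m::{t2_space,second_countable_topology} \<Rightarrow> (complex^'k::finite) set"
  assumes A: "oriented_surface A" and V: "subbundle A V" and nd: "nondegenerate t V"
  obtains P where "smooth_map A P" "\<And>p w. proj t (V p) w = P p *v w"
    "\<And>p w. proj t (perp t (V p)) w = w - P p *v w" "\<And>p. P p ** P p = P p"
proof -
  have nd': "v = 0" if "v \<in> V p" "\<And>w. w \<in> V p \<Longrightarrow> mform t v w = 0" for v p
    using nd that unfolding nondegenerate_def by blast
  define P where "P x = matrix (proj t (V x))" for x
  have ex: "\<exists>z\<in>V p. w - z \<in> perp t (V p)" "vec.subspace (V p)" for p w
  proof -
    obtain U T and f :: "'k \<Rightarrow> 'm \<Rightarrow> complex^'k" where U: "open U" "p \<in> U" "\<forall>b. smooth_map_on A U (f b)"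
      and frame: "\<forall>x\<in>U. (\<forall>b. b \<notin> T \<longrightarrow> f b x = 0) \<and> vec.span (range (\<lambda>b. f b x)) = V x \<and>
        (\<forall>c b. (\<Sum>b\<in>UNIV. c $ b *s f b x) = 0 \<longrightarrow> b \<in> T \<longrightarrow> c $ b = 0)"
      using ex_padded_frame[OF V, of p] by blast
    have f: "\<And>x b. x \<in> U \<Longrightarrow> b \<notin> T \<Longrightarrow> f b x = 0"
      "\<And>x. x \<in> U \<Longrightarrow> vec.span (range (\<lambda>b. f b x)) = V x"
      "\<And>x c b. x \<in> U \<Longrightarrow> (\<Sum>b\<in>UNIV. c $ b *s f b x) = 0 \<Longrightarrow> b \<in> T \<Longrightarrow> c $ b = 0"
      using frame by blast+
    show "\<exists>z\<in>V p. w - z \<in> perp t (V p)"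
      using proj_padded_frame(2,3)[of T "\<lambda>b. f b p" "V p" t w, OF f[OF U(2)] nd'[of _ p]] by blast
    show "vec.subspace (V p)"
      unfolding f(2)[OF U(2), symmetric] by (rule vec.subspace_span)
  qed
  have P: "proj t (V p) w = P p *v w" "proj t (perp t (V p)) w = w - P p *v w" "P p ** P p = P p" for p w
    using matrix_proj_props[where W = "V p" and t = t, OF ex(2)[of p] nd'[of _ p] ex(1)[where p = p]]
    unfolding P_def by blast+
  have "smooth_on (coord \<phi>) (\<lambda>y. proj t (V (chart_inv \<phi> y)) w)" if \<phi>: "\<phi> \<in> A" for \<phi> w
  proof (rule smooth_on_local)
    fix y assume y: "y \<in> coord \<phi>"
    define p where "p = chart_inv \<phi> y"
    obtain U T and f :: "'k \<Rightarrow> 'm \<Rightarrow> complex^'k" where U: "open U" "p \<in> U" "\<forall>b. smooth_map_on A U (f b)"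
      and frame: "\<forall>x\<in>U. (\<forall>b. b \<notin> T \<longrightarrow> f b x = 0) \<and> vec.span (range (\<lambda>b. f b x)) = V x \<and>
        (\<forall>c b. (\<Sum>b\<in>UNIV. c $ b *s f b x) = 0 \<longrightarrow> b \<in> T \<longrightarrow> c $ b = 0)"
      using ex_padded_frame[OF V, of p] by blast
    have f: "\<And>x b. x \<in> U \<Longrightarrow> b \<notin> T \<Longrightarrow> f b x = 0"
      "\<And>x. x \<in> U \<Longrightarrow> vec.span (range (\<lambda>b. f b x)) = V x"
      "\<And>x c b. x \<in> U \<Longrightarrow> (\<Sum>b\<in>UNIV. c $ b *s f b x) = 0 \<Longrightarrow> b \<in> T \<Longrightarrow> c $ b = 0"
      using frame by blast+
    define O' where "O' = snd \<phi> ` (fst \<phi> \<inter> U)"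
    have o: "open O'" unfolding O'_def by (rule open_coord_image[OF A \<phi> U(1)])
    have yO: "y \<in> O'"
      using chart_inv_in[OF A y] coord_chart_inv[OF A y] U(2) unfolding O'_def p_def
      by (metis IntI image_eqI)
    have inU: "chart_inv \<phi> y \<in> U" if "y \<in> O'" for y
      using that chart_inv_coord[OF A \<phi>] by (auto simp: O'_def)
    define G where "G y = (\<chi> a b. mform t (f a (chart_inv \<phi> y)) (f b (chart_inv \<phi> y)) +
        (if a = b \<and> a \<notin> T then 1 else 0) :: complex^'k^'k)" for y
    have sf: "smooth_on O' (\<lambda>y. f b (chart_inv \<phi> y))" for b
      using U(3) \<phi> unfolding smooth_map_on_def O'_def o_def by blast
    have sG: "smooth_on O' (\<lambda>y. G y $ i $ j)" for i j
      unfolding G_def vec_lambda_beta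
      by (intro smooth_on_add[OF o] smooth_on_bilinear[OF o bounded_bilinear_mform] sf smooth_on_const)
    have pf: "det (G y) \<noteq> 0" "proj t (V (chart_inv \<phi> y)) w =
        (\<Sum>b\<in>UNIV. (det (\<chi> i j. if j = b then mform t (f i (chart_inv \<phi> y)) w else G y $ i $ j) *
          inverse (det (G y))) *s f b (chart_inv \<phi> y))" if "y \<in> O'" for y
    proof -
      note pf = proj_padded_frame[where T = T and f = "\<lambda>b. f b (chart_inv \<phi> y)"
          and W = "V (chart_inv \<phi> y)" and t = t,
          OF f[OF inU[OF that]] nd'[where p = "chart_inv \<phi> y"], folded G_def]
      show "det (G y) \<noteq> 0" by (rule pf(1))
      show "proj t (V (chart_inv \<phi> y)) w =
        (\<Sum>b\<in>UNIV. (det (\<chi> i j. if j = b then mform t (f i (chart_inv \<phi> y)) w else G y $ i $ j) *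
          inverse (det (G y))) *s f b (chart_inv \<phi> y))" by (rule pf(4))
    qed
    have "smooth_on O' (\<lambda>y. \<Sum>b\<in>UNIV. (det (\<chi> i j. if j = b then mform t (f i (chart_inv \<phi> y)) w
        else G y $ i $ j) * inverse (det (G y))) *s f b (chart_inv \<phi> y))"
    proof (intro smooth_on_sum[OF o] smooth_on_bilinear[OF o bounded_bilinear_vector_smult]
        smooth_on_mult[OF o] smooth_on_det[OF o] smooth_on_inverse[OF o] sf sG)
      show "smooth_on O' (\<lambda>y. (\<chi> i j. if j = b then mform t (f i (chart_inv \<phi> y)) w
          else G y $ i $ j) $ i $ j)" for b i j
        by (cases "j = b") (simp_all add: sG smooth_on_bilinear[OF o bounded_bilinear_mform sf smooth_on_const])
    qed (use pf(1) in auto)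
    then have "smooth_on O' (\<lambda>y. proj t (V (chart_inv \<phi> y)) w)"
      by (rule smooth_on_cong[OF o, rotated]) (simp add: pf(2))
    with o yO show "\<exists>U. open U \<and> y \<in> U \<and> smooth_on U (\<lambda>y. proj t (V (chart_inv \<phi> y)) w)"
      by blast
  qed
  \<comment> \<open>The columns of \<open>P\<close> are the projections of the constant basis
    vectors.\<close>
  then have "smooth_map A P"
    unfolding smooth_map_iff[OF A] P_def matrix_def
    by (intro ballI smooth_on_vec_lambda smooth_on_vec_nth open_coord[OF A]) auto
  then show ?thesis by (rule that[OF _ P])
qed


section \<open>Connections and the splitting of a connection along a subbundle\<close>

context
  fixes A :: "('m::{t2_space,second_countable_topology}) chart set"
  assumes A: "oriented_surface A"
begin

lemma connection_one_form: "connection A D \<Longrightarrow> smooth_map A s \<Longrightarrow> one_form A (D s)"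
  unfolding connection_def by blast

lemma connection_add:
  "connection A D \<Longrightarrow> smooth_map A s \<Longrightarrow> smooth_map A s' \<Longrightarrow> \<phi> \<in> A \<Longrightarrow> p \<in> fst \<phi> \<Longrightarrow>
    D (\<lambda>x. s x + s' x) \<phi> p u = D s \<phi> p u + D s' \<phi> p u"
  unfolding connection_def by blast

lemma connection_scale:
  "connection A D \<Longrightarrow> smooth_map A f \<Longrightarrow> smooth_map A s \<Longrightarrow> \<phi> \<in> A \<Longrightarrow> p \<in> fst \<phi> \<Longrightarrow>
    D (\<lambda>x. f x *s s x) \<phi> p u = d0 f \<phi> p u *s s p + f p *s D s \<phi> p u"
  unfolding connection_def by blast

lemma connection_sum:
  assumes D: "connection A D" and I: "finite I" and f: "\<And>i. smooth_map A (f i)"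
    and \<phi>: "\<phi> \<in> A" "p \<in> fst \<phi>"
  shows "D (\<lambda>x. \<Sum>i\<in>I. f i x) \<phi> p u = (\<Sum>i\<in>I. D (f i) \<phi> p u)"
proof -
  \<comment> \<open>Leibniz rule with the constant function 0; it starts the induction over the
    index set.\<close>
  have zero: "D (\<lambda>x. 0) \<phi> p u = 0"
    using connection_scale[OF D smooth_map_const[OF A, of 0] smooth_map_const[OF A, of 0] \<phi>] by simp
  have "smooth_map A (\<lambda>x. \<Sum>i\<in>I. f i x) \<and> D (\<lambda>x. \<Sum>i\<in>I. f i x) \<phi> p u = (\<Sum>i\<in>I. D (f i) \<phi> p u)"
    using I
  proof (induction I)
    case empty
    show ?case using zero smooth_map_const[OF A] by simp
  next
    case (insert i I)
    then show ?case
      using connection_add[OF D f[of i] _ \<phi>, of "\<lambda>x. \<Sum>i\<in>I. f i x"] smooth_map_add[OF A f[of i], of "\<lambda>x. \<Sum>i\<in>I. f i x"]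
      by simp
  qed
  then show ?thesis by simp
qed

text \<open>Expand the section in the constant frame: the Leibniz rule differentiates the
  coefficients, and \<open>end_form\<close> records the action on the frame.\<close>

lemma connection_eq_d0_plus_end_form:
  assumes D: "connection A D" and s: "smooth_map A s" and \<phi>: "\<phi> \<in> A" "p \<in> fst \<phi>"
  shows "D s \<phi> p u = d0 s \<phi> p u + end_form D \<phi> p u *v s p"
proof -
  have c: "smooth_map A (\<lambda>x. s x $ i)" for i
    by (rule smooth_map_linear[OF A bounded_linear_vec_nth s])
  have "D (\<lambda>x. s x $ i *s axis i 1) \<phi> p u
      = d0 (\<lambda>x. s x $ i) \<phi> p u *s axis i 1 + s p $ i *s D (\<lambda>_. axis i 1) \<phi> p u" for i
    by (rule connection_scale[OF D c smooth_map_const[OF A] \<phi>])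
  moreover have "d0 (\<lambda>x. s x $ i) \<phi> p u = d0 s \<phi> p u $ i" for i
    by (rule d0_bounded_linear[OF bounded_linear_vec_nth smooth_map_differentiable[OF A s \<phi>]])
  moreover have "D (\<lambda>x. \<Sum>i\<in>UNIV. s x $ i *s axis i 1) \<phi> p u = (\<Sum>i\<in>UNIV. D (\<lambda>x. s x $ i *s axis i 1) \<phi> p u)"
    by (intro connection_sum[OF D _ _ \<phi>] smooth_map_bilinear[OF A bounded_bilinear_vector_smult c]
        smooth_map_const[OF A]) simp
  ultimately have "D s \<phi> p u = (\<Sum>i\<in>UNIV. d0 s \<phi> p u $ i *s axis i 1) + (\<Sum>i\<in>UNIV. s p $ i *s D (\<lambda>_. axis i 1) \<phi> p u)"
    by (simp add: basis_expansion sum.distrib)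
  then show ?thesis
    by (simp add: basis_expansion end_form_def matrix_def matrix_vector_mult_def vec_eq_iff mult.commute)
qed

lemma one_form_end_form:
  assumes "\<And>v. one_form A (D (\<lambda>_. v))"
  shows "one_form A (end_form D)"
proof (rule one_formI[OF A])
  show "linear (end_form D \<phi> p)" if "\<phi> \<in> A" "p \<in> fst \<phi>" for \<phi> p
    using linear_add[OF one_form_linear[OF A assms that]] linear_scale[OF one_form_linear[OF A assms that]]
    by (intro linearI) (simp_all add: end_form_def matrix_def vec_eq_iff)
  show "smooth_on (coord \<phi>) (\<lambda>x. end_form D \<phi> (chart_inv \<phi> x) u)" if "\<phi> \<in> A" for \<phi> u
    unfolding end_form_def matrix_def
    by (intro smooth_on_vec_lambda smooth_on_vec_nth open_coord[OF A that] one_form_smooth[OF A assms that])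
qed (simp add: end_form_def one_form_trans[OF A assms])

text \<open>The converse of the expansion above. Since d kills constant sections, evaluating on them
  recovers the form B.\<close>

lemma connectionI:
  fixes D :: "('m, 'k::finite) operator"
  assumes one: "\<And>s. smooth_map A s \<Longrightarrow> one_form A (D s)"
    and repr: "\<And>s \<phi> p u. smooth_map A s \<Longrightarrow> \<phi> \<in> A \<Longrightarrow> p \<in> fst \<phi> \<Longrightarrow> D s \<phi> p u = d0 s \<phi> p u + B \<phi> p u *v s p"
  shows "connection A D"
    and "\<phi> \<in> A \<Longrightarrow> p \<in> fst \<phi> \<Longrightarrow> end_form D \<phi> p u = B \<phi> p u"
proof -
  show "connection A D"
    unfolding connection_def
  proof (intro conjI allI impI ballI one)
    fix s s' :: "'m \<Rightarrow> complex^'k" and \<phi> p u assume s: "smooth_map A s" "smooth_map A s'" and \<phi>: "\<phi> \<in> A" "p \<in> fst \<phi>"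
    show "D (\<lambda>x. s x + s' x) \<phi> p u = D s \<phi> p u + D s' \<phi> p u"
      by (simp add: repr smooth_map_add[OF A] s \<phi> d0_add smooth_map_differentiable[OF A] matrix_vector_right_distrib)
  next
    fix f :: "'m \<Rightarrow> complex" and s :: "'m \<Rightarrow> complex^'k" and \<phi> p u
    assume s: "smooth_map A f" "smooth_map A s" and \<phi>: "\<phi> \<in> A" "p \<in> fst \<phi>"
    show "D (\<lambda>x. f x *s s x) \<phi> p u = d0 f \<phi> p u *s s p + f p *s D s \<phi> p u"
      by (simp add: repr smooth_map_bilinear[OF A bounded_bilinear_vector_smult] s \<phi>
          d0_bilinear[OF A bounded_bilinear_vector_smult] smooth_map_differentiable[OF A]
          vector_scalar_commute[symmetric] vec.scale_right_distrib)
  qed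
  show "end_form D \<phi> p u = B \<phi> p u" if "\<phi> \<in> A" "p \<in> fst \<phi>"
    by (simp add: end_form_def repr[OF smooth_map_const[OF A] that])
qed

lemma connection_one_form_end_form: "connection A D \<Longrightarrow> one_form A (end_form D)"
  by (intro one_form_end_form connection_one_form smooth_map_const[OF A])

text \<open>The terms in which B meets a first derivative of s cancel. What is left besides the
  curvature is dds, the antisymmetrised second derivative.\<close>

lemma dcov_connection:
  assumes D: "connection A D" and s: "smooth_map A s" and \<phi>: "\<phi> \<in> A" "p \<in> fst \<phi>"
  shows "dcov D (D s) \<phi> p u v = d1 (d0 s) \<phi> p u v + curvature (end_form D) \<phi> p u v *v s p"
proof -
  note repr = connection_eq_d0_plus_end_form[OF D s \<phi>(1)]
  note dE = one_form_differentiable[OF A connection_one_form_end_form[OF D] \<phi>]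
    and ds = smooth_map_differentiable[OF A s \<phi>]
  note bb = bounded_bilinear_matrix_vector_mult
  have "d0 (\<lambda>x. D s \<phi> x w) \<phi> p z = d0 (\<lambda>x. d0 s \<phi> x w) \<phi> p z +
      (end_form D \<phi> p w *v d0 s \<phi> p z + d0 (\<lambda>x. end_form D \<phi> x w) \<phi> p z *v s p)" for w z
  proof -
    have "d0 (\<lambda>x. D s \<phi> x w) \<phi> p z = d0 (\<lambda>x. d0 s \<phi> x w + end_form D \<phi> x w *v s x) \<phi> p z"
      by (subst d0_cong[OF A \<phi> repr]) auto
    also have "\<dots> = d0 (\<lambda>x. d0 s \<phi> x w) \<phi> p z + d0 (\<lambda>x. end_form D \<phi> x w *v s x) \<phi> p z"
      by (intro d0_add smooth_map_d0_differentiable[OF A s \<phi>] chart_differentiable_bilinear[OF bb dE ds])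
    finally show ?thesis by (simp add: d0_bilinear[OF A bb \<phi> dE ds])
  qed
  then show ?thesis
    by (simp add: dcov_def d1_def curvature_def lie_def repr[OF \<phi>(2)] matrix_vector_right_distrib
        matrix_vector_mult_add_rdistrib matrix_vector_mult_diff_rdistrib matrix_vector_mul_assoc algebra_simps)
qed

text \<open>Constant sections detect the curvature; for the others only \<open>d d s\<close> is left. So a flat
  connection yields the symmetry of second derivatives of sections.\<close>

lemma flat_connection_imp:
  fixes D :: "('m, 'k::finite) operator"
  assumes flat: "flat_connection A D" and \<phi>: "\<phi> \<in> A" "p \<in> fst \<phi>"
  shows "curvature (end_form D) \<phi> p u v = 0"
    and "smooth_map A s \<Longrightarrow> d1 (d0 s :: ('m, complex^'k) form1) \<phi> p u v = 0"
proof -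
  have eq: "d1 (d0 s) \<phi> p u v + curvature (end_form D) \<phi> p u v *v s p = 0"
    if s: "smooth_map A s" for s :: "'m \<Rightarrow> complex^'k"
  proof -
    have "connection A D" "dcov D (D s) \<phi> p u v = 0"
      using flat \<phi> s by (auto simp: flat_connection_def eq2_def)
    then show ?thesis using dcov_connection[OF _ s \<phi>] by metis
  qed
  have "curvature (end_form D) \<phi> p u v *v w = 0" for w
    using eq[OF smooth_map_const[OF A], of w] by (simp add: d1_def)
  then show 0: "curvature (end_form D) \<phi> p u v = 0"
    by (simp add: matrix_eq)
  show "d1 (d0 s) \<phi> p u v = 0" if "smooth_map A s" for s :: "'m \<Rightarrow> complex^'k"
    using eq[OF that] by (simp add: 0)
qed

text \<open>The hypothesis \<open>d\<close>, symmetry of second derivatives, is supplied by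
  \<open>flat_connection_imp\<close> from the original flat connection.\<close>

lemma flat_connection_iff:
  assumes D: "connection A D"
    and d: "\<And>s \<phi> p u v. smooth_map A s \<Longrightarrow> \<phi> \<in> A \<Longrightarrow> p \<in> fst \<phi> \<Longrightarrow> d1 (d0 s :: ('m, complex^'k::finite) form1) \<phi> p u v = 0"
  shows "flat_connection A (D :: ('m, 'k) operator) \<longleftrightarrow>
    (\<forall>\<phi>\<in>A. \<forall>p\<in>fst \<phi>. \<forall>u v. curvature (end_form D) \<phi> p u v = 0)"
proof
  show "\<forall>\<phi>\<in>A. \<forall>p\<in>fst \<phi>. \<forall>u v. curvature (end_form D) \<phi> p u v = 0" if "flat_connection A D"
    using flat_connection_imp(1)[OF that] by blast
  show "flat_connection A D" if "\<forall>\<phi>\<in>A. \<forall>p\<in>fst \<phi>. \<forall>u v. curvature (end_form D) \<phi> p u v = 0"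
    using that D by (simp add: flat_connection_def eq2_def dcov_connection d)
qed

text \<open>Symmetry is known for vector-valued sections; it passes to \<open>P\<close> by applying
  \<open>P\<close> to each constant vector.\<close>

lemma d1_d0_matrix:
  fixes P :: "'m \<Rightarrow> complex^'k::finite^'k"
  assumes P: "smooth_map A P" and \<phi>: "\<phi> \<in> A" "p \<in> fst \<phi>"
    and d: "\<And>s. smooth_map A s \<Longrightarrow> d1 (d0 s :: ('m, complex^'k) form1) \<phi> p u v = 0"
  shows "d1 (d0 P) \<phi> p u v = 0"
proof -
  note bl = bounded_bilinear.bounded_linear_left[OF bounded_bilinear_matrix_vector_mult]
  have "d0 (\<lambda>x. d0 (\<lambda>y. P y *v w) \<phi> x a) \<phi> p b = d0 (\<lambda>x. d0 P \<phi> x a) \<phi> p b *v w" for w a b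
  proof -
    have "d0 (\<lambda>x. d0 (\<lambda>y. P y *v w) \<phi> x a) \<phi> p b = d0 (\<lambda>x. d0 P \<phi> x a *v w) \<phi> p b"
      by (subst d0_cong[OF A \<phi> d0_bounded_linear[OF bl smooth_map_differentiable[OF A P \<phi>(1)]]]) auto
    then show ?thesis
      by (simp add: d0_bounded_linear[OF bl smooth_map_d0_differentiable[OF A P \<phi>]])
  qed
  then have "d1 (d0 P) \<phi> p u v *v w = d1 (d0 (\<lambda>x. P x *v w)) \<phi> p u v" for w
    by (simp add: d1_def matrix_vector_mult_diff_rdistrib)
  then show ?thesis
    unfolding matrix_eq by (simp add: d[OF smooth_map_linear[OF A bl P]])
qed

lemma curvature_cong:
  assumes "\<phi> \<in> A" "p \<in> fst \<phi>" "\<And>x u. x \<in> fst \<phi> \<Longrightarrow> B \<phi> x u = B' \<phi> x u"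
  shows "curvature B \<phi> p u v = curvature B' \<phi> p u v"
  using assms d0_cong[OF A assms(1,2), of "\<lambda>x. B \<phi> x u" "\<lambda>x. B' \<phi> x u" for u]
  by (simp add: curvature_def d1_def)

end

text \<open>The second hypothesis is the derivative of PP = P; multiplying it by P from the left
  isolates the product.\<close>

lemma idempotent_derivative_sandwich:
  fixes P P' :: "complex^'k::finite^'k"
  assumes "P ** P = P" "P' = P ** P' + P' ** P"
  shows "P ** P' ** P = 0"
proof -
  have "P ** P' = P ** (P ** P' + P' ** P)" using assms(2) by simp
  then show ?thesis by (simp add: matrix_distribs assms(1))
qed

section \<open>The diagonal and off-diagonal parts of a connection relative to a projection\<close>

context
  fixes A :: "('m::{t2_space,second_countable_topology}) chart set"
    and D :: "('m, 'k::finite) operator" and V :: "'m \<Rightarrow> (complex^'k) set" and P t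
  assumes A: "oriented_surface A" and D: "connection A D"
    and P: "smooth_map A P" "\<And>p w. proj t (V p) w = P p *v w"
      "\<And>p w. proj t (perp t (V p)) w = w - P p *v w" "\<And>p. P p ** P p = P p"
begin

lemma d0_projection:
  assumes \<phi>: "\<phi> \<in> A" "p \<in> fst \<phi>"
  shows "d0 P \<phi> p u = P p ** d0 P \<phi> p u + d0 P \<phi> p u ** P p"
  using d0_bilinear[OF A bounded_bilinear_matrix_mult \<phi> smooth_map_differentiable[OF A P(1) \<phi>]
      smooth_map_differentiable[OF A P(1) \<phi>]] unfolding P(4) .

lemma one_form_calD:
  assumes s: "smooth_map A s"
  shows "one_form A (calD t V D s)"
proof -
  note bb = bounded_bilinear_matrix_vector_mult
  note Ps = smooth_map_bilinear[OF A bb P(1) s]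
  show ?thesis
    unfolding calD_def[abs_def] P(2,3)
    by (intro one_form_add[OF A] one_form_diff[OF A] one_form_bilinear[OF A bb P(1)] connection_one_form[OF A D]
        smooth_map_diff[OF A] Ps s)
qed

text \<open>The zeroth-order part of P(d + B)P + (1 - P)(d + B)(1 - P). The first two terms arise
  when d falls on the inner projections; as dP = P dP + dP P, together they are the commutator
  [P, dP].\<close>

definition calD_matrix :: "('m, 'k) endform" where
  "calD_matrix \<phi> p u = P p ** d0 P \<phi> p u - (mat 1 - P p) ** d0 P \<phi> p u
    + P p ** end_form D \<phi> p u ** P p + (mat 1 - P p) ** end_form D \<phi> p u ** (mat 1 - P p)"

lemma calD_eq:
  assumes s: "smooth_map A s" and \<phi>: "\<phi> \<in> A" "p \<in> fst \<phi>"
  shows "calD t V D s \<phi> p u = d0 s \<phi> p u + calD_matrix \<phi> p u *v s p"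
proof -
  note bb = bounded_bilinear_matrix_vector_mult
  note Ps = smooth_map_bilinear[OF A bb P(1) s]
  note repr = connection_eq_d0_plus_end_form[OF A D _ \<phi>]
  have 1: "d0 (\<lambda>x. P x *v s x) \<phi> p u = P p *v d0 s \<phi> p u + d0 P \<phi> p u *v s p"
    by (intro d0_bilinear[OF A bb \<phi>] smooth_map_differentiable[OF A _ \<phi>] P(1) s)
  have 2: "d0 (\<lambda>x. s x - P x *v s x) \<phi> p u = d0 s \<phi> p u - d0 (\<lambda>x. P x *v s x) \<phi> p u"
    by (intro d0_diff smooth_map_differentiable[OF A _ \<phi>] Ps s)
  show ?thesis
    unfolding calD_def P(2,3) repr[OF Ps] repr[OF smooth_map_diff[OF A s Ps]] 1 2 calD_matrix_def
    by (simp only: matrix_vector_right_distrib matrix_vector_mult_diff_distrib matrix_vector_mult_add_rdistrib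
        matrix_vector_mult_diff_rdistrib matrix_vector_mul_assoc matrix_distribs matrix_mul_lid matrix_mul_rid
        matrix_vector_mul_lid P(4)) (simp add: algebra_simps)
qed

lemma connection_calD: "connection A (calD t V D)"
  by (rule connectionI(1)[OF A one_form_calD calD_eq])

lemma end_form_calD:
  "\<phi> \<in> A \<Longrightarrow> p \<in> fst \<phi> \<Longrightarrow> end_form (calD t V D) \<phi> p u = calD_matrix \<phi> p u"
  by (rule connectionI(2)[OF A one_form_calD calD_eq])

lemma one_form_calN: "one_form A (calN t V D)"
proof -
  have "one_form A (D (\<lambda>_. v))" for v
    by (rule connection_one_form[OF A D smooth_map_const[OF A]])
  then show ?thesis
    unfolding calN_def
    by (intro one_form_end_form[OF A] one_form_diff[OF A] one_form_calD smooth_map_const[OF A])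
qed

lemma end_form_split:
  assumes \<phi>: "\<phi> \<in> A" "p \<in> fst \<phi>"
  shows "end_form D \<phi> p u = end_form (calD t V D) \<phi> p u + calN t V D \<phi> p u"
  by (simp add: calN_def end_form_def matrix_def vec_eq_iff)

text \<open>The two B-terms of \<open>calD_matrix\<close> are block-diagonal and commute with P. The
  rest is [P, dP], and [P, [P, dP]] = dP because dP is off-diagonal.\<close>

lemma calD_parallel:
  assumes \<phi>: "\<phi> \<in> A" "p \<in> fst \<phi>"
  shows "d0 P \<phi> p u = P p ** end_form (calD t V D) \<phi> p u - end_form (calD t V D) \<phi> p u ** P p"
proof -
  define P' where "P' = d0 P \<phi> p u"
  have h: "P' = P p ** P' + P' ** P p" unfolding P'_def by (rule d0_projection[OF \<phi>])
  have idem: "X ** P p ** P p = X ** P p" for X :: "complex^'k^'k"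
    by (simp add: P(4) flip: matrix_mul_assoc)
  then have "P p ** calD_matrix \<phi> p u - calD_matrix \<phi> p u ** P p = P p ** P' + P' ** P p"
    unfolding calD_matrix_def P'_def[symmetric]
    by (simp only: matrix_distribs matrix_mul_lid matrix_mul_rid P(4) idem
        idempotent_derivative_sandwich[OF P(4) h]) (simp add: algebra_simps)
  then show ?thesis
    using h by (simp add: end_form_calD[OF \<phi>] P'_def)
qed

text \<open>Subtracting \<open>calD_matrix\<close> from B leaves PB(1 - P) + (1 - P)BP - [P, dP],
  and each of these terms is off-diagonal.\<close>

lemma calN_exchanges:
  assumes \<phi>: "\<phi> \<in> A" "p \<in> fst \<phi>"
  shows "P p ** calN t V D \<phi> p u + calN t V D \<phi> p u ** P p = calN t V D \<phi> p u"
proof -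
  define P' where "P' = d0 P \<phi> p u"
  define B where "B = end_form D \<phi> p u"
  have h: "P' = P p ** P' + P' ** P p" unfolding P'_def by (rule d0_projection[OF \<phi>])
  have idem: "X ** P p ** P p = X ** P p" for X :: "complex^'k^'k"
    by (simp add: P(4) flip: matrix_mul_assoc)
  have N: "calN t V D \<phi> p u = B - calD_matrix \<phi> p u"
    using end_form_split[OF \<phi>, of u] end_form_calD[OF \<phi>, of u] by (simp add: B_def)
  have "P p ** (B - calD_matrix \<phi> p u) + (B - calD_matrix \<phi> p u) ** P p
      = (P p ** P' + P' ** P p) - P p ** P' - P p ** P'
        - P p ** B ** P p - P p ** B ** P p + P p ** B + B ** P p"
    unfolding calD_matrix_def P'_def[symmetric] B_def[symmetric]
    by (simp only: matrix_distribs matrix_mul_lid matrix_mul_rid P(4) idem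
        idempotent_derivative_sandwich[OF P(4) h]) (simp add: algebra_simps)
  also have "\<dots> = B - calD_matrix \<phi> p u"
    unfolding h[symmetric] calD_matrix_def P'_def[symmetric] B_def[symmetric]
    by (simp only: matrix_distribs matrix_mul_lid matrix_mul_rid) (simp add: algebra_simps)
  finally show ?thesis unfolding N .
qed

end


section \<open>The spectral family\<close>

context
  fixes A :: "('m::{t2_space,second_countable_topology}) chart set" and C and J :: "('m, real^2) form1"
    and B N q :: "('m, 'k::finite) endform" and E :: "('m, 'k) operator"
  assumes A: "oriented_surface A" and C: "conformal_structure A C"
    and J: "induced_complex_structure A C J"
    and B: "one_form A (end_form E)" and N: "one_form A N" and q: "one_form A q"
begin

lemma bracket_wedge_parts:
  assumes \<phi>: "\<phi> \<in> A" "p \<in> fst \<phi>" and \<mu>: "one_form A (\<mu> :: ('m, 'k) endform)" and \<eta>: "one_form A \<eta>"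
  shows "bracket_wedge (part10 J \<mu>) (part10 J \<eta>) \<phi> p u v = 0"
    and "bracket_wedge (part01 J \<mu>) (part01 J \<eta>) \<phi> p u v = 0"
  using bracket_wedge_same_type[OF A C J one_form_part10[OF A C J \<mu>] one_form_part10[OF A C J \<eta>] \<phi>]
    bracket_wedge_same_type[OF A C J one_form_part01[OF A C J \<mu>] one_form_part01[OF A C J \<eta>] \<phi>]
    part10_J[OF A C J _ \<phi>] part01_J[OF A C J _ \<phi>] \<mu> \<eta> by blast+

lemma bracket_wedge_self:
  assumes \<phi>: "\<phi> \<in> A" "p \<in> fst \<phi>" and \<mu>: "one_form A (\<mu> :: ('m, 'k) endform)"
  shows "bracket_wedge \<mu> \<mu> \<phi> p u v = cscale 2 (bracket_wedge (part10 J \<mu>) (part01 J \<mu>) \<phi> p u v)"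
proof -
  have "bracket_wedge \<mu> \<mu> \<phi> p u v = bracket_wedge (\<lambda>\<phi> p u. part10 J \<mu> \<phi> p u + part01 J \<mu> \<phi> p u)
      (\<lambda>\<phi> p u. part10 J \<mu> \<phi> p u + part01 J \<mu> \<phi> p u) \<phi> p u v"
    unfolding part10_add_part01 ..
  also have "\<dots> = cscale 2 (bracket_wedge (part10 J \<mu>) (part01 J \<mu>) \<phi> p u v)"
    unfolding bracket_wedge_add bracket_wedge_parts[OF \<phi> \<mu> \<mu>]
      bracket_wedge_commute[of "part01 J \<mu>" "part10 J \<mu>"]
    by (simp add: vec_eq_iff)
  finally show ?thesis .
qed

lemma dcov_End_split:
  assumes \<phi>: "\<phi> \<in> A" "p \<in> fst \<phi>" and \<mu>: "one_form A (\<mu> :: ('m, 'k) endform)"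
  shows "dcov_End E \<mu> \<phi> p u v = dcov_End E (part10 J \<mu>) \<phi> p u v + dcov_End E (part01 J \<mu>) \<phi> p u v"
  using dcov_End_add[OF A one_form_part10[OF A C J \<mu>] one_form_part01[OF A C J \<mu>] \<phi>, of E u v]
  unfolding part10_add_part01 .

text \<open>By the hypothesis, the two parts of N have opposite covariant derivatives, so the left
  side is -2i times that of the (1,0)-part. On the right only brackets of mixed type survive, and 2i
  can be cancelled.\<close>

lemma dcov_End_star_iff:
  assumes \<phi>: "\<phi> \<in> A" "p \<in> fst \<phi>" and 0: "dcov_End E N \<phi> p u v = 0"
  shows "dcov_End E (star J N) \<phi> p u v = cscale 2 (bracket_wedge q (star J N) \<phi> p u v) \<longleftrightarrow>
    dcov_End E (part10 J N) \<phi> p u v + bracket_wedge (part01 J N) (part10 J q) \<phi> p u v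
      - bracket_wedge (part10 J N) (part01 J q) \<phi> p u v = 0"
proof -
  note one = one_form_part10[OF A C J N] one_form_part01[OF A C J N]
  have d01: "dcov_End E (part01 J N) \<phi> p u v = - dcov_End E (part10 J N) \<phi> p u v"
    using 0 dcov_End_split[OF \<phi> N] by (simp add: eq_neg_iff_add_eq_0 add.commute)
  have L: "dcov_End E (star J N) \<phi> p u v = cscale (- 2 * \<i>) (dcov_End E (part10 J N) \<phi> p u v)"
    unfolding star_conv_parts dcov_End_add[OF A one_form_bounded_linear[OF A bounded_linear_cscale one(1)]
        one_form_bounded_linear[OF A bounded_linear_cscale one(2)] \<phi>]
      dcov_End_cscale[OF A one(1) \<phi>] dcov_End_cscale[OF A one(2) \<phi>] d01
    by (simp add: vec_eq_iff)
  have "bracket_wedge q (star J N) \<phi> p u v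
      = bracket_wedge (\<lambda>\<phi> p u. part10 J q \<phi> p u + part01 J q \<phi> p u) (star J N) \<phi> p u v"
    unfolding part10_add_part01 ..
  also have "\<dots> = cscale \<i> (bracket_wedge (part01 J N) (part10 J q) \<phi> p u v)
      - cscale \<i> (bracket_wedge (part10 J N) (part01 J q) \<phi> p u v)"
    unfolding star_conv_parts bracket_wedge_add bracket_wedge_cscale bracket_wedge_parts[OF \<phi> q N]
      bracket_wedge_commute[of "part10 J q" "part01 J N"] bracket_wedge_commute[of "part01 J q" "part10 J N"]
    by (simp add: vec_eq_iff)
  finally have R: "bracket_wedge q (star J N) \<phi> p u v
      = cscale \<i> (bracket_wedge (part01 J N) (part10 J q) \<phi> p u v)
      - cscale \<i> (bracket_wedge (part10 J N) (part01 J q) \<phi> p u v)" .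
  have "- 2 * \<i> * a = 2 * (\<i> * b - \<i> * c) \<longleftrightarrow> a + b - c = 0" for a b c :: complex
  proof -
    have "- 2 * \<i> * a = 2 * (\<i> * b - \<i> * c) \<longleftrightarrow> 2 * \<i> * (a + b - c) = 0"
      by (auto simp: algebra_simps eq_neg_iff_add_eq_0)
    then show ?thesis by simp
  qed
  then show ?thesis
    unfolding L R by (simp add: vec_eq_iff)
qed

text \<open>Put c = l^-2 - 1 and d = l^2 - 1. The coefficients of the two parts of N multiply to 1,
  so their bracket cancels the curvature of \<open>E\<close>. Since cd = -(c + d), the bracket of
  the two parts of q is shared between the first two terms. The mixed brackets of N and q get the
  coefficients c l = 1/l - l and d / l = -(1/l - l), which also explains the signs in the last
  term.\<close>

lemma curvature_spectral:
  assumes \<phi>: "\<phi> \<in> A" "p \<in> fst \<phi>" and l: "l \<noteq> 0" and dN: "dcov_End E N \<phi> p u v = 0"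
    and flat: "curvature (end_form E) \<phi> p u v + cscale (1/2) (bracket_wedge N N \<phi> p u v) = 0"
  shows "curvature (\<lambda>\<phi> p u. end_form E \<phi> p u + (cscale (1 / l) (part10 J N \<phi> p u)
      + cscale l (part01 J N \<phi> p u) + cscale (1 / l^2 - 1) (part10 J q \<phi> p u)
      + cscale (l^2 - 1) (part01 J q \<phi> p u))) \<phi> p u v =
    cscale (1 / l^2 - 1) (dcov_End E (part10 J q) \<phi> p u v - cscale (1/2) (bracket_wedge q q \<phi> p u v))
    + cscale (l^2 - 1) (dcov_End E (part01 J q) \<phi> p u v - cscale (1/2) (bracket_wedge q q \<phi> p u v))
    + cscale (1 / l - l) (dcov_End E (part10 J N) \<phi> p u v
      + bracket_wedge (part01 J N) (part10 J q) \<phi> p u v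
      - bracket_wedge (part10 J N) (part01 J q) \<phi> p u v)"
proof -
  let ?N1 = "part10 J N" and ?N2 = "part01 J N" and ?q1 = "part10 J q" and ?q2 = "part01 J q"
  note one = one_form_part10[OF A C J N] one_form_part01[OF A C J N]
    one_form_part10[OF A C J q] one_form_part01[OF A C J q]
  note sone = one[THEN one_form_bounded_linear[OF A bounded_linear_cscale]]
  note add1 = one_form_add[OF A sone(1) sone(2)]
  note add2 = one_form_add[OF A add1 sone(3)]
  have d01: "dcov_End E ?N2 \<phi> p u v = - dcov_End E ?N1 \<phi> p u v"
    using dN dcov_End_split[OF \<phi> N] by (simp add: eq_neg_iff_add_eq_0 add.commute)
  have curv: "curvature (end_form E) \<phi> p u v = - bracket_wedge ?N1 ?N2 \<phi> p u v"
    using flat unfolding bracket_wedge_self[OF \<phi> N]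
    by (simp add: vec_eq_iff eq_neg_iff_add_eq_0)
  show ?thesis
    unfolding curvature_add[OF A B one_form_add[OF A add2 sone(4)] \<phi>]
      dcov_End_add[OF A add2 sone(4) \<phi>] dcov_End_add[OF A add1 sone(3) \<phi>]
      dcov_End_add[OF A sone(1,2) \<phi>] one[THEN dcov_End_cscale[OF A _ \<phi>]]
      bracket_wedge_add bracket_wedge_cscale bracket_wedge_parts[OF \<phi> N N] bracket_wedge_parts[OF \<phi> q q]
      bracket_wedge_parts[OF \<phi> N q] bracket_wedge_parts[OF \<phi> q N]
      bracket_wedge_commute[of ?N2 ?N1] bracket_wedge_commute[of ?q2 ?q1]
      bracket_wedge_commute[of ?q1 ?N2] bracket_wedge_commute[of ?q2 ?N1]
      bracket_wedge_self[OF \<phi> q] d01 curv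
    using l by (simp add: vec_eq_iff field_simps power2_eq_square)
qed

end

lemma laurent_coefficients_vanish:
  fixes X Y Z :: "complex^'k::finite^'k"
  shows "(\<forall>l. l \<noteq> 0 \<longrightarrow> cscale (1 / l^2 - 1) X + cscale (l^2 - 1) Y + cscale (1 / l - l) Z = 0) \<longleftrightarrow>
    X = 0 \<and> Y = 0 \<and> Z = 0"
proof
  assume *: "\<forall>l. l \<noteq> 0 \<longrightarrow> cscale (1 / l^2 - 1) X + cscale (l^2 - 1) Y + cscale (1 / l - l) Z = 0"
  have "X $ i $ j = 0 \<and> Y $ i $ j = 0 \<and> Z $ i $ j = 0" for i j
  proof -
    let ?x = "X $ i $ j" and ?y = "Y $ i $ j" and ?z = "Z $ i $ j"
    have eq: "(1 / l^2 - 1) * ?x + (l^2 - 1) * ?y + (1 / l - l) * ?z = 0" if "l \<noteq> 0" for l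
      using * that by (auto simp: vec_eq_iff)
    \<comment> \<open>All three coefficients vanish at 1 and -1. Passing from 2 to -2 flips only the
      coefficient of z, which gives z = 0; then the values at 2 and 3 say x = 4y and x = 9y.\<close>
    have e: "- 3 / 4 * ?x + 3 * ?y - 3 / 2 * ?z = 0" "- 3 / 4 * ?x + 3 * ?y + 3 / 2 * ?z = 0"
      "- 8 / 9 * ?x + 8 * ?y - 8 / 3 * ?z = 0"
      using eq[of 2] eq[of "- 2"] eq[of 3] by simp_all
    have z: "?z = 0" using e(1,2) by algebra
    have "- 3 / 4 * ?x + 3 * ?y = 0" "- 8 / 9 * ?x + 8 * ?y = 0" using e(1,3) z by simp_all
    then have "?x = 0 \<and> ?y = 0" by algebra
    with z show ?thesis by simp
  qed
  then show "X = 0 \<and> Y = 0 \<and> Z = 0" by (simp add: vec_eq_iff)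
qed (simp add: vec_eq_iff)

theorem theorem6p6:
  fixes n :: nat
    and t :: "'k::finite"
    and A :: "('m::{t2_space,second_countable_topology}) chart set"
    and C :: "'m metric set"
    and J :: "('m, real^2) form1"
    and D :: "('m, 'k) operator"
    and V :: "'m \<Rightarrow> (complex^'k) set"
    and q :: "('m, 'k) endform"
  assumes "n \<ge> 3" and "CARD('k) = n + 2"
    and "oriented_surface A"
    and "conformal_structure A C"
    and "induced_complex_structure A C J"
    and "metric_connection t A D"
    and "flat_connection A D"
    and "subbundle A V"
    and "nondegenerate t V"
    and "one_form A q"
    and "\<forall>\<phi>\<in>A. \<forall>p\<in>fst \<phi>. \<forall>u.
      q \<phi> p u \<in> {a + b |a b. a \<in> wedge2 t (V p) \<and> b \<in> wedge2 t (perp t (V p))}"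
  shows "constrained_harmonic t A J q D V \<longleftrightarrow>
    (\<forall>l::complex. l \<noteq> 0 \<longrightarrow> flat_connection A (spectral_deformation t J q D V l))"
proof -
  note A = assms(3) and ACJ = assms(3-5) and flat = assms(7) and q = assms(10)
  have D: "connection A D" using flat by (simp add: flat_connection_def)
  obtain P where P: "smooth_map A P" "\<And>p w. proj t (V p) w = P p *v w"
    "\<And>p w. proj t (perp t (V p)) w = w - P p *v w" "\<And>p. P p ** P p = P p"
    using ex_smooth_projection[OF A assms(8,9)] by metis
  let ?E = "calD t V D" and ?N = "calN t V D"
  note E = connection_calD[OF A D P] and N = one_form_calN[OF A D P]
  note B = connection_one_form_end_form[OF A E]
  note dd0 = flat_connection_imp(2)[OF A flat]
  have dN: "dcov_End ?E ?N \<phi> p u v = 0"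
    and curv: "curvature (end_form ?E) \<phi> p u v + cscale (1/2) (bracket_wedge ?N ?N \<phi> p u v) = 0"
    if \<phi>: "\<phi> \<in> A" "p \<in> fst \<phi>" for \<phi> p u v
  proof -
    let ?X = "curvature (end_form ?E) \<phi> p u v + cscale (1/2) (bracket_wedge ?N ?N \<phi> p u v)"
      and ?Y = "dcov_End ?E ?N \<phi> p u v"
    have off: "P p ** ?N \<phi> p w + ?N \<phi> p w ** P p = ?N \<phi> p w" for w
      by (rule calN_exchanges[OF A D P \<phi>])
    then have PN: "P p ** ?N \<phi> p w = ?N \<phi> p w - ?N \<phi> p w ** P p" for w
      by (metis add_diff_cancel_right')
    \<comment> \<open>A product of two off-diagonal matrices is block-diagonal.\<close>
    then have "P p ** (?N \<phi> p w ** ?N \<phi> p z) = (?N \<phi> p w ** ?N \<phi> p z) ** P p" for w z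
      by (simp add: matrix_distribs PN) (simp add: matrix_distribs PN flip: matrix_mul_assoc)
    then have "P p ** lie (?N \<phi> p u) (?N \<phi> p v) = lie (?N \<phi> p u) (?N \<phi> p v) ** P p"
      by (simp add: lie_def matrix_distribs)
    moreover have "P p ** curvature (end_form ?E) \<phi> p u v = curvature (end_form ?E) \<phi> p u v ** P p"
      by (rule curvature_commutes_with_projection[OF A B P(1) \<phi> calD_parallel[OF A D P \<phi>(1)]
            d1_d0_matrix[OF A P(1) \<phi> dd0[OF \<phi>]]])
    ultimately have X: "P p ** ?X = ?X ** P p"
      unfolding lie_eq_bracket_wedge[symmetric] by (simp add: matrix_distribs)
    have Y: "P p ** ?Y + ?Y ** P p = ?Y"
      by (rule dcov_End_exchanges_projection[OF A B N P(1) \<phi> calD_parallel[OF A D P \<phi>(1)]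
            calN_exchanges[OF A D P \<phi>(1)]])
    have "0 = curvature (end_form D) \<phi> p u v"
      by (simp add: flat_connection_imp(1)[OF A flat \<phi>])
    also have "\<dots> = curvature (\<lambda>\<phi> p u. end_form ?E \<phi> p u + ?N \<phi> p u) \<phi> p u v"
      by (rule curvature_cong[OF A \<phi>], rule end_form_split[OF A D P \<phi>(1)])
    also have "\<dots> = ?X + ?Y"
      by (simp add: curvature_add[OF A B N \<phi>])
    finally have "?X + ?Y = 0" by simp
    from commuting_exchanging_disjoint[OF P(4) X Y this] show "?Y = 0" "?X = 0" by auto
  qed
  define M where "M l = (\<lambda>\<phi> p u. cscale (1 / l) (part10 J ?N \<phi> p u) + cscale l (part01 J ?N \<phi> p u)
      + cscale (1 / l^2 - 1) (part10 J q \<phi> p u) + cscale (l^2 - 1) (part01 J q \<phi> p u))" for l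
  have M: "one_form A (M l)" for l
    unfolding M_def
    by (intro one_form_add[OF A] one_form_bounded_linear[OF A bounded_linear_cscale]
        one_form_part10[OF ACJ] one_form_part01[OF ACJ] N q)
  let ?S = "spectral_deformation t J q D V"
  have S: "?S l s \<phi> p u = ?E s \<phi> p u + M l \<phi> p u *v s p" for l s \<phi> p u
    by (simp add: spectral_deformation_def M_def)
  have one: "one_form A (?S l s)" if "smooth_map A s" for l s
  proof -
    have "one_form A (\<lambda>\<phi> p u. M l \<phi> p u *v s p)"
      by (rule one_form_bilinear[OF A bounded_bilinear.flip[OF bounded_bilinear_matrix_vector_mult] that M])
    from one_form_add[OF A connection_one_form[OF A E that] this] show ?thesis
      by (simp add: S[abs_def])
  qed
  have repr: "?S l s \<phi> p u = d0 s \<phi> p u + (end_form ?E \<phi> p u + M l \<phi> p u) *v s p"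
    if "smooth_map A s" "\<phi> \<in> A" "p \<in> fst \<phi>" for l s \<phi> p u
    by (simp add: S connection_eq_d0_plus_end_form[OF A E that] matrix_vector_mult_add_rdistrib)
  have SC: "connection A (?S l)" for l
    by (rule connectionI(1)[OF A one repr])
  have Send: "end_form (?S l) \<phi> p u = end_form ?E \<phi> p u + M l \<phi> p u" if "\<phi> \<in> A" "p \<in> fst \<phi>" for l \<phi> p u
    by (rule connectionI(2)[OF A one repr that])
  have Sflat: "flat_connection A (?S l) \<longleftrightarrow>
      (\<forall>\<phi>\<in>A. \<forall>p\<in>fst \<phi>. \<forall>u v. curvature (end_form (?S l)) \<phi> p u v = 0)" for l
    by (rule flat_connection_iff[OF A SC]) (rule dd0)
  let ?F1 = "\<lambda>\<phi> p u v. dcov_End ?E (part10 J q) \<phi> p u v - cscale (1/2) (bracket_wedge q q \<phi> p u v)"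
    and ?F2 = "\<lambda>\<phi> p u v. dcov_End ?E (part01 J q) \<phi> p u v - cscale (1/2) (bracket_wedge q q \<phi> p u v)"
    and ?F3 = "\<lambda>\<phi> p u v. dcov_End ?E (part10 J ?N) \<phi> p u v
      + bracket_wedge (part01 J ?N) (part10 J q) \<phi> p u v
      - bracket_wedge (part10 J ?N) (part01 J q) \<phi> p u v"
  have curvS: "curvature (end_form (?S l)) \<phi> p u v = cscale (1 / l^2 - 1) (?F1 \<phi> p u v)
      + cscale (l^2 - 1) (?F2 \<phi> p u v) + cscale (1 / l - l) (?F3 \<phi> p u v)"
    if "\<phi> \<in> A" "p \<in> fst \<phi>" "l \<noteq> 0" for l \<phi> p u v
    unfolding curvature_spectral[OF ACJ B N q that(1-3) dN[OF that(1,2)] curv[OF that(1,2)], symmetric]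
    by (rule curvature_cong[OF A that(1,2)]) (simp add: Send[OF that(1)] M_def)
  \<comment> \<open>The third equation can be replaced by its (1,0)-version because
    \<open>dN\<close> holds everywhere.\<close>
  have "constrained_harmonic t A J q D V \<longleftrightarrow>
      (\<forall>\<phi>\<in>A. \<forall>p\<in>fst \<phi>. \<forall>u v. ?F1 \<phi> p u v = 0 \<and> ?F2 \<phi> p u v = 0 \<and> ?F3 \<phi> p u v = 0)"
    using dcov_End_star_iff[OF ACJ B N q _ _ dN]
    by (auto simp: constrained_harmonic_def eq2_def)
  \<comment> \<open>The quantifier over l stands innermost, so coefficients are compared at one
    point and one pair of tangent vectors at a time.\<close>
  also have "\<dots> \<longleftrightarrow> (\<forall>\<phi>\<in>A. \<forall>p\<in>fst \<phi>. \<forall>u v. \<forall>l. l \<noteq> 0 \<longrightarrow> curvature (end_form (?S l)) \<phi> p u v = 0)"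
    by (intro ball_cong refl arg_cong[where f = All] ext)
      (simp add: curvS laurent_coefficients_vanish)
  also have "\<dots> \<longleftrightarrow> (\<forall>l. l \<noteq> 0 \<longrightarrow> flat_connection A (?S l))"
    using Sflat by blast
  finally show ?thesis .
qed

end
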